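(* Let $p,p'$ be relatively prime integers greater than $1$, let $a',b,b'$ be positive integers and let $c$ be a non-negative integer such that $a'>c$, $3b$ divides $p$, and $a'b'$ divides $p'$. Put $B=bb'$ and $n=\dfrac{pp'}{3a'bb'}$. Let $\mathcal A_1^{(3)}$ be the set of pairs of integers $(r,s)$ with $0<r<p/b$, $0<s<p'/b'$ and $\dfrac{p'r/b'-ps/b-a'+3c}{6a'}\in\mathbb Z$, and let $\mathcal A_2^{(3)}$ be the set of pairs of integers $(r,s)$ with $0<r<p/b$, $0<s<p'/b'$ and $\dfrac{p'r/b'+ps/b+a'-3c}{6a'}\in\mathbb Z$. Then the following identity of formal power series in $q$ holds: $$\frac{(q^{Bc},q^{B(2a'-c)},q^{2Ba'};q^{2Ba'})_\infty\,(q^{2B(a'+c)},q^{2B(a'-c)};q^{4Ba'})_\infty}{(q^n;q^n)_\infty}=q^{\frac{(p-p')^2-(a'-3c)^2B^2}{12Ba'}}\Big(\sum_{(r,s)\in\mathcal A_1^{(3)}}\chi_{rb,sb'}^{(p,p')}(q^n)-\sum_{(r,s)\in\mathcal A_2^{(3)}}\chi_{rb,sb'}^{(p,p')}(q^n)\Big).$$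
   Context: Notation: $(u_1,\dots,u_k;v)_\infty:=\prod_{i=0}^\infty\prod_{j=1}^k(1-u_jv^i)$ and $(q)_\infty=\prod_{j=1}^\infty(1-q^j)$. For relatively prime integers $p,p'>1$ and integers $1\le r\le p-1$, $1\le s\le p'-1$, $\chi_{r,s}^{(p,p')}(q)$ denotes the formal character $\mathrm{Tr}(q^{L_0})$ of the irreducible Virasoro module $M^{(p,p')}_{r,s}$ of the $(p,p')$ minimal series; it is given (Rocha-Caridi formula) by $$\chi_{r,s}^{(p,p')}(q)=\frac{q^{-\frac{(p'-p)^2}{4pp'}}}{(q)_\infty}\left(\sum_{j\in\mathbb Z}q^{\frac{(2pp'j+p'r-ps)^2}{4pp'}}-\sum_{j\in\mathbb Z}q^{\frac{(2pp'j+p'r+ps)^2}{4pp'}}\right),$$ which may be taken as its definition. It is a formal series in rational powers of $q$; $\chi(q^n)$ means that every exponent is multiplied by $n$. *)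

theory Defs
  imports
    "HOL-Analysis.Analysis"
    "HOL-Library.Groups_Big_Fun"
begin

section \<open>Formal series in rational powers of \<open>q\<close>\<close>

text \<open>
  An element is given by the coefficient of \<open>q\<^sup>e\<close> for every rational \<open>e\<close>; only finitely many
  exponents below any given bound may occur. This makes the Cauchy product a finite sum.
\<close>

definition left_finite :: "(rat \<Rightarrow> 'a::zero) \<Rightarrow> bool" where
  "left_finite f \<longleftrightarrow> (\<forall>x. finite {e. e \<le> x \<and> f e \<noteq> 0})"

typedef (overloaded) 'a qseries = "{f :: rat \<Rightarrow> 'a::zero. left_finite f}"
  morphisms qcoeff Abs_qseries
  by (rule exI[of _ "\<lambda>_. 0"]) (simp add: left_finite_def)

setup_lifting type_definition_qseries

lemma qseries_eqI: "(\<And>e. qcoeff f e = qcoeff g e) \<Longrightarrow> f = g"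
  by (metis ext qcoeff_inject)

lemma left_finite_qcoeff [simp]: "left_finite (qcoeff f)"
  using qcoeff by blast

lemma left_finite_lower_bound:
  assumes "left_finite f"
  obtains m where "\<And>e. f e \<noteq> 0 \<Longrightarrow> m \<le> e"
proof (cases "\<exists>e. f e \<noteq> 0")
  case True
  then obtain x where x: "f x \<noteq> 0" by blast
  let ?S = "{e. e \<le> x \<and> f e \<noteq> 0}"
  have fin: "finite ?S" using assms by (auto simp: left_finite_def)
  have "Min ?S \<le> e" if "f e \<noteq> 0" for e
  proof (cases "e \<le> x")
    case True
    with that fin show ?thesis by (intro Min_le) auto
  next
    case False
    have "Min ?S \<le> x" using fin x by (intro Min_le) auto
    with False show ?thesis by linarith
  qed
  then show ?thesis using that by blast
qed (use that in blast)

definition qconv :: "(rat \<Rightarrow> 'a::semiring_0) \<Rightarrow> (rat \<Rightarrow> 'a) \<Rightarrow> rat \<Rightarrow> 'a" where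
  "qconv f g e = Sum_any (\<lambda>a. f a * g (e - a))"

lemma qconv_eq_sum:
  assumes "finite A" "\<And>a. f a \<noteq> 0 \<Longrightarrow> g (e - a) \<noteq> 0 \<Longrightarrow> a \<in> A"
  shows   "qconv f g e = (\<Sum>a\<in>A. f a * g (e - a))"
  unfolding qconv_def using assms by (intro Sum_any.expand_superset) (auto dest: mult_not_zero)

lemma left_finite_qconv:
  fixes f g :: "rat \<Rightarrow> 'a::semiring_0"
  assumes f: "left_finite f" and g: "left_finite g"
  shows   "left_finite (qconv f g)"
  unfolding left_finite_def
proof
  fix x
  obtain m where m: "\<And>e. f e \<noteq> 0 \<Longrightarrow> m \<le> e" using left_finite_lower_bound[OF f] by blast
  obtain k where k: "\<And>e. g e \<noteq> 0 \<Longrightarrow> k \<le> e" using left_finite_lower_bound[OF g] by blast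
  let ?A = "{e. e \<le> x - k \<and> f e \<noteq> 0}" and ?B = "{e. e \<le> x - m \<and> g e \<noteq> 0}"
  have "{e. e \<le> x \<and> qconv f g e \<noteq> 0} \<subseteq> (\<lambda>(a, b). a + b) ` (?A \<times> ?B)"
  proof
    fix e assume e: "e \<in> {e. e \<le> x \<and> qconv f g e \<noteq> 0}"
    then obtain a where "f a * g (e - a) \<noteq> 0"
      unfolding qconv_def by (auto elim: Sum_any.not_neutral_obtains_not_neutral)
    then have a: "f a \<noteq> 0" "g (e - a) \<noteq> 0" by auto
    with m[of a] k[of "e - a"] e have "(a, e - a) \<in> ?A \<times> ?B" by auto
    then show "e \<in> (\<lambda>(a, b). a + b) ` (?A \<times> ?B)" by force
  qed
  moreover have "finite (?A \<times> ?B)" using f g by (auto simp: left_finite_def)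
  ultimately show "finite {e. e \<le> x \<and> qconv f g e \<noteq> 0}"
    by (meson finite_imageI finite_subset)
qed

lemma qconv_commute:
  fixes f g :: "rat \<Rightarrow> 'a::comm_semiring_0"
  shows "qconv f g = qconv g f"
proof
  fix e
  show "qconv f g e = qconv g f e"
    unfolding qconv_def
  proof (rule Sum_any.reindex_cong)
    show "bij (\<lambda>a. e - a)" by (rule o_bij[of "\<lambda>a. e - a"]) auto
  qed (auto simp: mult.commute)
qed

lemma finite_qconv_support:
  assumes "left_finite f" "left_finite (g :: rat \<Rightarrow> 'a::zero)"
  shows   "finite {a. f a \<noteq> 0 \<and> g (e - a) \<noteq> 0}"
proof -
  obtain k where k: "\<And>e. g e \<noteq> 0 \<Longrightarrow> k \<le> e" using left_finite_lower_bound[OF assms(2)] by blast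
  have "{a. f a \<noteq> 0 \<and> g (e - a) \<noteq> 0} \<subseteq> {a. a \<le> e - k \<and> f a \<noteq> 0}"
    using k by (force simp: algebra_simps)
  then show ?thesis using assms(1) unfolding left_finite_def by (meson finite_subset)
qed

lemma qconv_assoc:
  fixes f g h :: "rat \<Rightarrow> 'a::semiring_0"
  assumes f: "left_finite f" and g: "left_finite g" and h: "left_finite h"
  shows   "qconv (qconv f g) h = qconv f (qconv g h)"
proof
  fix e
  obtain mf where mf: "\<And>e. f e \<noteq> 0 \<Longrightarrow> mf \<le> e" using left_finite_lower_bound[OF f] by blast
  obtain mg where mg: "\<And>e. g e \<noteq> 0 \<Longrightarrow> mg \<le> e" using left_finite_lower_bound[OF g] by blast
  obtain mh where mh: "\<And>e. h e \<noteq> 0 \<Longrightarrow> mh \<le> e" using left_finite_lower_bound[OF h] by blast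
  define A where "A = {a. a \<le> e - mg - mh \<and> f a \<noteq> 0}"
  define B where "B = {a. a \<le> e - mf - mh \<and> g a \<noteq> 0}"
  define X where "X = (\<lambda>(a, b). a + b) ` (A \<times> B)"
  have fin: "finite A" "finite B" "finite X"
    using f g by (auto simp: A_def B_def X_def left_finite_def)
  have AB: "a \<in> A \<and> b \<in> B" if "f a \<noteq> 0" "g b \<noteq> 0" "h (e - a - b) \<noteq> 0" for a b
    using mf[OF that(1)] mg[OF that(2)] mh[OF that(3)] that by (auto simp: A_def B_def)
  have 1: "qconv f g x * h (e - x) = (\<Sum>a\<in>A. f a * g (x - a) * h (e - x))" for x
  proof (cases "h (e - x) = 0")
    case False
    have "qconv f g x = (\<Sum>a\<in>A. f a * g (x - a))"
      using AB[of _ "x - _"] False fin by (intro qconv_eq_sum) auto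
    then show ?thesis by (simp add: sum_distrib_right)
  qed simp
  have "qconv (qconv f g) h e = (\<Sum>x\<in>X. qconv f g x * h (e - x))"
  proof (rule qconv_eq_sum)
    fix x assume x: "qconv f g x \<noteq> 0" "h (e - x) \<noteq> 0"
    then obtain a where "f a * g (x - a) \<noteq> 0"
      unfolding qconv_def by (auto elim: Sum_any.not_neutral_obtains_not_neutral)
    then have "f a \<noteq> 0" "g (x - a) \<noteq> 0" by auto
    with AB[of a "x - a"] x have "(a, x - a) \<in> A \<times> B" by auto
    then show "x \<in> X" unfolding X_def by force
  qed (use fin in auto)
  also have "\<dots> = (\<Sum>x\<in>X. \<Sum>a\<in>A. f a * g (x - a) * h (e - x))"
    by (simp only: 1)
  also have "\<dots> = (\<Sum>a\<in>A. \<Sum>x\<in>X. f a * g (x - a) * h (e - x))"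
    by (rule sum.swap)
  also have "\<dots> = (\<Sum>a\<in>A. f a * qconv g h (e - a))"
  proof (rule sum.cong)
    fix a assume a: "a \<in> A"
    have "qconv g h (e - a) = (\<Sum>b\<in>B. g b * h (e - a - b))"
      using AB[of a] a fin by (intro qconv_eq_sum) (auto simp: A_def)
    also have "\<dots> = (\<Sum>x\<in>(\<lambda>b. a + b) ` B. g (x - a) * h (e - x))"
      by (subst sum.reindex) (auto simp: algebra_simps)
    also have "\<dots> = (\<Sum>x\<in>X. g (x - a) * h (e - x))"
    proof (rule sum.mono_neutral_left)
      show "\<forall>x\<in>X - (+) a ` B. g (x - a) * h (e - x) = 0"
      proof
        fix x assume x: "x \<in> X - (+) a ` B"
        have "x - a \<notin> B"
        proof
          assume "x - a \<in> B"
          then have "a + (x - a) \<in> (+) a ` B" by blast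
          with x show False by simp
        qed
        then show "g (x - a) * h (e - x) = 0"
          using AB[of a "x - a"] a
          by (cases "g (x - a) = 0"; cases "h (e - x) = 0") (auto simp: A_def)
      qed
    qed (use a fin in \<open>auto simp: X_def\<close>)
    finally show "(\<Sum>x\<in>X. f a * g (x - a) * h (e - x)) = f a * qconv g h (e - a)"
      by (simp add: sum_distrib_left mult.assoc)
  qed simp
  also have "\<dots> = qconv f (qconv g h) e"
  proof (rule qconv_eq_sum[symmetric])
    fix a assume x: "f a \<noteq> 0" "qconv g h (e - a) \<noteq> 0"
    then obtain b where "g b * h (e - a - b) \<noteq> 0"
      unfolding qconv_def by (auto elim: Sum_any.not_neutral_obtains_not_neutral)
    then have "g b \<noteq> 0" "h (e - a - b) \<noteq> 0" by auto
    with AB[of a b] x show "a \<in> A" by auto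
  qed (use fin in auto)
  finally show "qconv (qconv f g) h e = qconv f (qconv g h) e" .
qed

lemma qconv_distrib_right:
  fixes f g h :: "rat \<Rightarrow> 'a::semiring_0"
  assumes f: "left_finite f" and g: "left_finite g" and h: "left_finite h"
  shows   "qconv (\<lambda>e. f e + g e) h e = qconv f h e + qconv g h e"
proof -
  let ?A = "{a. f a \<noteq> 0 \<and> h (e - a) \<noteq> 0} \<union> {a. g a \<noteq> 0 \<and> h (e - a) \<noteq> 0}"
  have fin: "finite ?A" using f g h by (auto intro: finite_qconv_support)
  have "qconv (\<lambda>e. f e + g e) h e = (\<Sum>a\<in>?A. (f a + g a) * h (e - a))"
    using fin by (intro qconv_eq_sum) auto
  moreover have "qconv f h e = (\<Sum>a\<in>?A. f a * h (e - a))"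
    using fin by (intro qconv_eq_sum) auto
  moreover have "qconv g h e = (\<Sum>a\<in>?A. g a * h (e - a))"
    using fin by (intro qconv_eq_sum) auto
  ultimately show ?thesis by (simp add: sum.distrib distrib_right)
qed

lemma left_finite_subset:
  assumes "left_finite f" "left_finite g" "\<And>e. h e \<noteq> 0 \<Longrightarrow> f e \<noteq> 0 \<or> g e \<noteq> 0"
  shows   "left_finite h"
  unfolding left_finite_def
proof
  fix x
  have "{e. e \<le> x \<and> h e \<noteq> 0} \<subseteq> {e. e \<le> x \<and> f e \<noteq> 0} \<union> {e. e \<le> x \<and> g e \<noteq> 0}"
    using assms(3) by auto
  then show "finite {e. e \<le> x \<and> h e \<noteq> 0}"
    using assms(1,2) unfolding left_finite_def by (meson finite_UnI finite_subset)
qed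

lemma left_finite_single: "left_finite (\<lambda>e. if e = a then c else 0)"
  unfolding left_finite_def by (auto intro: finite_subset[of _ "{a}"])

instantiation qseries :: (comm_ring_1) comm_ring_1
begin

lift_definition zero_qseries :: "'a qseries" is "\<lambda>_. 0"
  by (simp add: left_finite_def)

lift_definition one_qseries :: "'a qseries" is "\<lambda>e. if e = 0 then 1 else 0"
  by (rule left_finite_single)

lift_definition plus_qseries :: "'a qseries \<Rightarrow> 'a qseries \<Rightarrow> 'a qseries" is "\<lambda>f g e. f e + g e"
  by (erule (1) left_finite_subset) auto

lift_definition minus_qseries :: "'a qseries \<Rightarrow> 'a qseries \<Rightarrow> 'a qseries" is "\<lambda>f g e. f e - g e"
  by (erule (1) left_finite_subset) auto

lift_definition uminus_qseries :: "'a qseries \<Rightarrow> 'a qseries" is "\<lambda>f e. - f e"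
  by (simp add: left_finite_def)

lift_definition times_qseries :: "'a qseries \<Rightarrow> 'a qseries \<Rightarrow> 'a qseries" is qconv
  by (rule left_finite_qconv)

instance
proof
  fix f g h :: "'a qseries"
  show "f * g * h = f * (g * h)" by transfer (rule qconv_assoc)
  show "f * g = g * f" by transfer (rule qconv_commute)
  show "(f + g) * h = f * h + g * h" by transfer (simp add: fun_eq_iff qconv_distrib_right)
  show "1 * f = f"
  proof (transfer, rule ext)
    fix f :: "rat \<Rightarrow> 'a" and e
    have "qconv (\<lambda>e. if e = 0 then 1 else 0) f e =
            (\<Sum>a\<in>{0}. (if a = 0 then 1 else 0) * f (e - a))"
      by (rule qconv_eq_sum) (auto split: if_splits)
    then show "qconv (\<lambda>e. if e = 0 then 1 else 0) f e = f e" by simp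
  qed
  show "(0 :: 'a qseries) \<noteq> 1" by transfer (metis zero_neq_one)
  show "f + g + h = f + (g + h)" by transfer (simp add: add.assoc)
  show "f + g = g + f" by transfer (simp add: add.commute)
  show "0 + f = f" by transfer simp
  show "- f + f = 0" by transfer simp
  show "f - g = f + - g" by transfer simp
qed

end

lemma qcoeff_simps [simp]:
  "qcoeff 0 e = 0"
  "qcoeff (f + g) e = qcoeff f e + qcoeff g e"
  "qcoeff (f - g) e = qcoeff f e - qcoeff g e"
  "qcoeff (- f) e = - qcoeff f e"
     apply (transfer; simp)
    apply (transfer; simp)
   apply (transfer; simp)
  apply (transfer; simp)
  done

lift_definition qpow :: "rat \<Rightarrow> 'a::comm_ring_1 qseries"
  is "\<lambda>x e. if e = x then 1 else 0"
  by (rule left_finite_single)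

lemma qcoeff_qpow: "qcoeff (qpow x) e = (if e = x then 1 else 0)"
  by transfer simp

lemma qcoeff_qpow_mult: "qcoeff (qpow x * f) e = qcoeff f (e - x)"
proof (transfer, goal_cases)
  case (1 x f e)
  have "qconv (\<lambda>e. if e = x then 1 else 0) f e = (\<Sum>a\<in>{x}. (if a = x then 1 else 0) * f (e - a))"
    by (rule qconv_eq_sum) (auto split: if_splits)
  then show ?case by simp
qed

lemma qpow_add: "qpow (x + y) = qpow x * (qpow y :: 'a::comm_ring_1 qseries)"
  by (rule qseries_eqI) (auto simp: qcoeff_qpow_mult qcoeff_qpow algebra_simps)

lift_definition qseries_of_fps :: "'a::comm_ring_1 fps \<Rightarrow> 'a qseries"
  is "\<lambda>f e. if e \<in> \<nat> then fps_nth f (nat \<lfloor>e\<rfloor>) else 0"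
proof (goal_cases)
  case (1 f)
  have fin: "finite {e::rat. e \<le> x \<and> e \<in> \<nat>}" for x
  proof (rule finite_subset)
    show "{e::rat. e \<le> x \<and> e \<in> \<nat>} \<subseteq> of_nat ` {..nat \<lfloor>x\<rfloor>}"
      by (auto elim!: Nats_cases intro!: imageI simp: le_nat_iff le_floor_iff)
  qed auto
  show ?case unfolding left_finite_def
    by (intro allI finite_subset[OF _ fin]) (auto split: if_splits)
qed

text \<open>The substitution \<open>q \<mapsto> q\<^sup>n\<close> for positive \<open>n\<close>; the value at \<open>n = 0\<close> is a dummy.\<close>

lift_definition qsubst_pow :: "nat \<Rightarrow> 'a::comm_ring_1 qseries \<Rightarrow> 'a qseries"
  is "\<lambda>n f e. if n = 0 then 0 else f (e / of_nat n)"
proof (goal_cases)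
  case (1 n f)
  show ?case unfolding left_finite_def
  proof
    fix x
    show "finite {e. e \<le> x \<and> (if n = 0 then 0 else f (e / of_nat n)) \<noteq> 0}"
    proof (rule finite_subset)
      show "{e. e \<le> x \<and> (if n = 0 then 0 else f (e / of_nat n)) \<noteq> 0} \<subseteq>
            (\<lambda>e. e * of_nat n) ` {e. e \<le> x / of_nat n \<and> f e \<noteq> 0}"
      proof
        fix e assume "e \<in> {e. e \<le> x \<and> (if n = 0 then 0 else f (e / of_nat n)) \<noteq> 0}"
        then show "e \<in> (\<lambda>e. e * of_nat n) ` {e. e \<le> x / of_nat n \<and> f e \<noteq> 0}"
          by (intro image_eqI[of _ _ "e / of_nat n"]) (auto simp: divide_right_mono split: if_splits)
      qed
      show "finite ((\<lambda>e. e * of_nat n) ` {e. e \<le> x / of_nat n \<and> f e \<noteq> 0})"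
        using 1 by (auto simp: left_finite_def)
    qed
  qed
qed

lemma qsubst_pow_qpow: "n > 0 \<Longrightarrow> qsubst_pow n (qpow x) = qpow (of_nat n * x)"
  by transfer (auto simp: fun_eq_iff field_simps)

text \<open>
  Infinite sums are formed coefficientwise; \<open>formal_sum\<close> is only meaningful for families
  satisfying \<open>formally_summable\<close>, for which every coefficient is a finite sum.
\<close>

definition formally_summable :: "('i \<Rightarrow> 'a::comm_ring_1 qseries) \<Rightarrow> bool" where
  "formally_summable f \<longleftrightarrow> (\<forall>x. finite {(i, e). e \<le> x \<and> qcoeff (f i) e \<noteq> 0})"

definition formal_sum :: "('i \<Rightarrow> 'a::comm_ring_1 qseries) \<Rightarrow> 'a qseries" where
  "formal_sum f = Abs_qseries (\<lambda>e. Sum_any (\<lambda>i. qcoeff (f i) e))"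

lemma qcoeff_formal_sum:
  assumes "formally_summable f"
  shows   "qcoeff (formal_sum f) e = Sum_any (\<lambda>i. qcoeff (f i) e)"
proof -
  have "left_finite (\<lambda>e. Sum_any (\<lambda>i. qcoeff (f i) e))"
    unfolding left_finite_def
  proof
    fix x
    have "{e. e \<le> x \<and> Sum_any (\<lambda>i. qcoeff (f i) e) \<noteq> 0} \<subseteq>
            snd ` {(i, e). e \<le> x \<and> qcoeff (f i) e \<noteq> 0}"
      by (force elim: Sum_any.not_neutral_obtains_not_neutral)
    then show "finite {e. e \<le> x \<and> Sum_any (\<lambda>i. qcoeff (f i) e) \<noteq> 0}"
      using assms unfolding formally_summable_def by (meson finite_imageI finite_subset)
  qed
  then show ?thesis unfolding formal_sum_def by (simp add: Abs_qseries_inverse)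
qed

lemma formally_summable_theta:
  fixes A B C :: rat
  assumes "A > 0" "C > 0"
  shows   "formally_summable (\<lambda>j::int. qpow ((A * of_int j + B)\<^sup>2 / C) :: 'a::comm_ring_1 qseries)"
  unfolding formally_summable_def
proof
  fix x :: rat
  let ?e = "\<lambda>j::int. (A * of_int j + B)\<^sup>2 / C"
  define M where "M = (\<bar>x * C\<bar> + 1 + \<bar>B\<bar>) / A"
  have "{(j, e). e \<le> x \<and> qcoeff (qpow (?e j) :: 'a qseries) e \<noteq> 0} \<subseteq>
          (\<lambda>j. (j, ?e j)) ` {- \<lceil>M\<rceil>..\<lceil>M\<rceil>}"
  proof safe
    fix j e assume e: "e \<le> x" "qcoeff (qpow (?e j) :: 'a qseries) e \<noteq> 0"
    then have [simp]: "e = ?e j" by (auto simp: qcoeff_qpow split: if_splits)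
    have "(A * of_int j + B)\<^sup>2 \<le> x * C" using e assms by (simp add: field_simps)
    also have "\<dots> \<le> \<bar>x * C\<bar> * 1 + 1" by simp
    also have "\<dots> \<le> (\<bar>x * C\<bar> + 1) * (\<bar>x * C\<bar> + 1)"
      by (simp add: distrib_left distrib_right)
    finally have "(A * of_int j + B)\<^sup>2 \<le> (\<bar>x * C\<bar> + 1)\<^sup>2" by (simp add: power2_eq_square)
    then have "\<bar>A * of_int j + B\<bar> \<le> \<bar>x * C\<bar> + 1"
      by (simp add: abs_le_square_iff[symmetric])
    then have "\<bar>A * of_int j\<bar> \<le> \<bar>x * C\<bar> + 1 + \<bar>B\<bar>" by linarith
    then have "A * \<bar>of_int j\<bar> \<le> \<bar>x * C\<bar> + 1 + \<bar>B\<bar>"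
      using assms by (simp add: abs_mult)
    then have "\<bar>of_int j :: rat\<bar> \<le> M" using assms by (simp add: M_def field_simps)
    then have "of_int \<bar>j\<bar> \<le> (of_int \<lceil>M\<rceil> :: rat)"
      by (metis le_of_int_ceiling of_int_abs order_trans)
    then have "j \<in> {- \<lceil>M\<rceil>..\<lceil>M\<rceil>}" by auto
    then show "(j, e) \<in> (\<lambda>j. (j, ?e j)) ` {- \<lceil>M\<rceil>..\<lceil>M\<rceil>}" by auto
  qed
  then show "finite {(j, e). e \<le> x \<and> qcoeff (qpow (?e j) :: 'a qseries) e \<noteq> 0}"
    by (rule finite_subset) simp
qed

section \<open>Infinite products and minimal model characters\<close>

text \<open>
  \<open>qpoch [u\<^sub>1, \<dots>, u\<^sub>k] v\<close> is \<open>(u\<^sub>1, \<dots>, u\<^sub>k; v)\<^sub>\<infinity>\<close>; the infinite product is taken in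
  the \<open>X\<close>-adic topology of formal power series.
\<close>

definition qpoch :: "complex fps list \<Rightarrow> complex fps \<Rightarrow> complex fps" where
  "qpoch us v = prodinf (\<lambda>i. \<Prod>u\<leftarrow>us. 1 - u * v ^ i)"

definition euler_prod :: "complex fps" where
  "euler_prod = prodinf (\<lambda>j. 1 - fps_X ^ Suc j)"

text \<open>The Rocha-Caridi formula for \<open>\<chi>\<^bsub>r,s\<^esub>\<^bsup>(p,p')\<^esup>(q)\<close>.\<close>

definition virasoro_char :: "nat \<Rightarrow> nat \<Rightarrow> int \<Rightarrow> int \<Rightarrow> complex qseries" where
  "virasoro_char p p' r s =
     qpow (- ((of_nat p' - of_nat p)\<^sup>2 / (4 * of_nat p * of_nat p'))) *
     qseries_of_fps (inverse euler_prod) *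
     (formal_sum (\<lambda>j::int. qpow ((2 * of_nat p * of_nat p' * of_int j + of_nat p' * of_int r
                                   - of_nat p * of_int s)\<^sup>2 / (4 * of_nat p * of_nat p')))
      - formal_sum (\<lambda>j::int. qpow ((2 * of_nat p * of_nat p' * of_int j + of_nat p' * of_int r
                                   + of_nat p * of_int s)\<^sup>2 / (4 * of_nat p * of_nat p'))))"

definition A1_3 :: "nat \<Rightarrow> nat \<Rightarrow> nat \<Rightarrow> nat \<Rightarrow> nat \<Rightarrow> nat \<Rightarrow> (int \<times> int) set" where
  "A1_3 p p' a' b b' c = {(r, s).
     0 < r \<and> of_int r < (of_nat p / of_nat b :: rat) \<and>
     0 < s \<and> of_int s < (of_nat p' / of_nat b' :: rat) \<and>
     (of_nat p' * of_int r / of_nat b' - of_nat p * of_int s / of_nat b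
       - of_nat a' + 3 * of_nat c) / (6 * of_nat a') \<in> (\<int> :: rat set)}"

definition A2_3 :: "nat \<Rightarrow> nat \<Rightarrow> nat \<Rightarrow> nat \<Rightarrow> nat \<Rightarrow> nat \<Rightarrow> (int \<times> int) set" where
  "A2_3 p p' a' b b' c = {(r, s).
     0 < r \<and> of_int r < (of_nat p / of_nat b :: rat) \<and>
     0 < s \<and> of_int s < (of_nat p' / of_nat b' :: rat) \<and>
     (of_nat p' * of_int r / of_nat b' + of_nat p * of_int s / of_nat b
       + of_nat a' - 3 * of_nat c) / (6 * of_nat a') \<in> (\<int> :: rat set)}"

end

theory Submission
  imports Defs
begin

text \<open>
  Put \<open>P = p/b\<close>, \<open>Q = p'/b'\<close> and \<open>\<kappa> = B/(12a')\<close>, and for a set \<open>S\<close> of integers let \<open>\<Theta>(S)\<close> be the sum of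
  \<open>q\<close> to the power \<open>\<kappa> N\<^sup>2\<close> over all \<open>N \<in> S\<close> (\<open>theta_sum\<close> below). Both sides of the identity are
  \<open>1/(q\<^sup>n; q\<^sup>n)\<^sub>\<infinity>\<close> times the same power of \<open>q\<close> times a combination of such theta series.

  On the left, the numerator is the product side of the quintuple product identity; completing the
  square in the series side gives \<open>\<Theta>(N \<equiv> a' - 3c) - \<Theta>(N \<equiv> a' + 3c)\<close> with congruences modulo \<open>6a'\<close>
  (\<open>quintuple_product_theta_sum\<close>). On the right, the Rocha-Caridi formula turns the character with
  index \<open>(rb, sb')\<close> into \<open>\<Theta>(N \<equiv> Qr - Ps) - \<Theta>(N \<equiv> Qr + Ps)\<close> with congruences modulo \<open>2PQ\<close>
  (\<open>qsubst_virasoro_char\<close>).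

  What remains is a statement about residue classes (\<open>theta_sum_kac_difference\<close>). By the Chinese
  remainder theorem, every integer divisible by neither \<open>P\<close> nor \<open>Q\<close> is congruent modulo \<open>2PQ\<close> to exactly one
  of the numbers \<open>Ps + Qr\<close>, \<open>Ps - Qr\<close> with \<open>0 < r < P\<close>, \<open>0 < s < Q\<close> (\<open>theta_sum_kac\<close>). As \<open>6a'\<close> divides \<open>2PQ\<close>, each
  of the two classes modulo \<open>6a'\<close> splits accordingly, and the pairs \<open>(r, s)\<close> which occur are those of
  \<open>A1_3\<close> and \<open>A2_3\<close>: the first class, up to \<open>N \<mapsto> - N\<close>, directly by the definition of these sets, and the
  second because \<open>3\<close> divides \<open>P\<close> and \<open>a'\<close> divides \<open>Q\<close>, so that a condition on \<open>Qr - Ps\<close> modulo \<open>6a'\<close> amounts to one on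
  \<open>Qr + Ps\<close> (\<open>six_dvd_sign_change\<close>). Multiples of \<open>P\<close> or \<open>Q\<close> occur in these two classes only if \<open>c = 0\<close>, when both
  sides are zero.

  The quintuple product identity is obtained from the Jacobi triple product: the quintuple product
  times an Euler product is a product of two triple products, and its double series factors after
  a linear change of variables (\<open>quintuple_product\<close>). The triple product is in turn the limit of a
  polynomial identity with Gaussian binomial coefficients (\<open>finite_jacobi_triple\<close>). As all
  arguments are powers of \<open>q\<close>, these identities are proved without a second variable \<open>z\<close>.
\<close>

section \<open>Congruences modulo powers of \<open>X\<close> and infinite products\<close>

lemma fps_X_power_dvd_iff:
  fixes f :: "'a::comm_ring_1 fps"
  shows "fps_X ^ n dvd f \<longleftrightarrow> (\<forall>k<n. fps_nth f k = 0)"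
proof
  assume "fps_X ^ n dvd f"
  then obtain g where "f = fps_X ^ n * g" by (elim dvdE)
  then show "\<forall>k<n. fps_nth f k = 0" by (simp add: fps_X_power_mult_nth)
next
  assume *: "\<forall>k<n. fps_nth f k = 0"
  have "f = fps_X ^ n * fps_shift n f"
    using * by (intro fps_ext) (auto simp: fps_X_power_mult_nth)
  then show "fps_X ^ n dvd f" by (rule dvdI)
qed

lemma dvd_diff_trans:
  fixes a b c d :: "'a::comm_ring_1"
  shows "d dvd a - b \<Longrightarrow> d dvd b - c \<Longrightarrow> d dvd a - c"
  using dvd_add[of d "a - b" "b - c"] by simp

lemma dvd_diff_trans':
  fixes a b c d :: "'a::comm_ring_1"
  shows "d dvd a - b \<Longrightarrow> d dvd c - b \<Longrightarrow> d dvd a - c"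
  using dvd_diff[of d "a - b" "c - b"] by simp

lemma dvd_diff_mult:
  fixes a b c d e :: "'a::comm_ring_1"
  assumes "d dvd a - b" "d dvd c - e"
  shows   "d dvd a * c - b * e"
proof -
  have "a * c - b * e = (a - b) * c + b * (c - e)" by (simp add: algebra_simps)
  with assms show ?thesis by simp
qed

lemma fps_eqI_mod_X_power:
  fixes f g :: "'a::comm_ring_1 fps"
  assumes "\<And>n. fps_X ^ n dvd f - g"
  shows "f = g"
proof (rule fps_ext)
  fix k
  show "fps_nth f k = fps_nth g k"
    using assms[of "Suc k"] unfolding fps_X_power_dvd_iff by auto
qed

text \<open>
  Convergence is handled by congruences modulo \<open>X\<^sup>N\<close>, written as divisibility of the difference: if
  the \<open>i\<close>-th factor is \<open>1\<close> modulo \<open>X\<^sup>i\<close>, factors from the \<open>N\<close>-th on do not change the product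
  modulo \<open>X\<^sup>N\<close>.
\<close>

lemma fps_partial_prod_mod:
  fixes f :: "nat \<Rightarrow> 'a::comm_ring_1 fps"
  assumes "\<And>i. fps_X ^ i dvd f i - 1" "N \<le> M"
  shows "fps_X ^ N dvd (\<Prod>i<M. f i) - (\<Prod>i<N. f i)"
  using assms(2)
proof (induction M rule: dec_induct)
  case (step M)
  have "fps_X ^ N dvd f M - 1"
    by (rule dvd_trans[OF le_imp_power_dvd assms(1)[of M]]) (use step in simp)
  from dvd_diff_mult[OF step.IH this] show ?case by simp
qed simp

text \<open>
  All that is ever used about an infinite product is that its \<open>N\<close>-th partial product approximates
  it modulo \<open>X\<^sup>N\<close>. The \<open>0\<close>-th factor is unconstrained and may vanish, as it does for
  \<open>(u; v)\<^sub>\<infinity>\<close> at \<open>u = 1\<close>; the factors from the first on have constant term \<open>1\<close>, so their product has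
  a nonzero limit \<open>p\<close>, and the whole product is \<open>f 0 * p\<close> in either case.
\<close>

lemma fps_prodinf_mod:
  fixes f :: "nat \<Rightarrow> 'a::idom fps"
  assumes f: "\<And>i. fps_X ^ i dvd f i - 1"
  shows "fps_X ^ N dvd prodinf f - (\<Prod>i<N. f i)"
proof -
  \<comment> \<open>The limit of the product without its \<open>0\<close>-th factor.\<close>
  define p where "p = Abs_fps (\<lambda>k. fps_nth (\<Prod>i<Suc k. f (Suc i)) k)"
  have f': "fps_X ^ i dvd f (Suc i) - 1" for i
    by (rule dvd_trans[OF le_imp_power_dvd f[of "Suc i"]]) simp
  have p: "fps_nth (\<Prod>i<M. f (Suc i)) k = fps_nth p k" if "k < M" for k M
    using fps_partial_prod_mod[of "\<lambda>i. f (Suc i)" "Suc k" M, OF f'] that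
    unfolding fps_X_power_dvd_iff by (simp add: p_def)
  have "(\<lambda>M. \<Prod>i<M. f (Suc i)) \<longlonglongrightarrow> p"
    by (rule tendsto_fpsI, rule eventually_mono[OF eventually_gt_at_top]) (rule p)
  then have lim: "(\<lambda>M. \<Prod>i\<le>M. f (i + Suc 0)) \<longlonglongrightarrow> p"
    by (simp add: LIMSEQ_lessThan_iff_atMost)
  have f0: "fps_nth (f (Suc 0)) 0 = 1"
    using f[of "Suc 0"] unfolding fps_X_power_dvd_iff by simp
  have "fps_nth p 0 = 1" by (simp add: p_def f0)
  then have "p \<noteq> 0" by auto
  then have raw: "raw_has_prod f (Suc 0) p" using lim by (simp add: raw_has_prod_def)
  have fp: "fps_nth (\<Prod>i<M. f i) k = fps_nth (f 0 * p) k" if kM: "Suc k < M" for k M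
  proof -
    obtain M' where M: "M = Suc M'" "k < M'" using kM by (cases M) auto
    have "fps_nth (\<Prod>i<M. f i) k = fps_nth (f 0 * (\<Prod>i<M'. f (Suc i))) k"
      unfolding M by (subst prod.lessThan_Suc_shift) simp
    also have "\<dots> = fps_nth (f 0 * p) k"
      unfolding fps_mult_nth by (intro sum.cong refl) (use p M in auto)
    finally show ?thesis .
  qed
  have "f has_prod (f 0 * p)"
  proof (cases "f 0 = 0")
    case True
    then show ?thesis using raw by (auto simp: has_prod_def)
  next
    case False
    have "(\<lambda>M. \<Prod>i<M. f i) \<longlonglongrightarrow> f 0 * p"
    proof (rule tendsto_fpsI)
      fix k
      show "\<forall>\<^sub>F M in sequentially. fps_nth (\<Prod>i<M. f i) k = fps_nth (f 0 * p) k"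
        using eventually_gt_at_top[of "Suc k"] by eventually_elim (rule fp)
    qed
    then have "(\<lambda>M. \<Prod>i\<le>M. f (i + 0)) \<longlonglongrightarrow> f 0 * p"
      by (simp add: LIMSEQ_lessThan_iff_atMost)
    then show ?thesis using False \<open>p \<noteq> 0\<close> by (simp add: has_prod_def raw_has_prod_def)
  qed
  then have eq: "prodinf f = f 0 * p" using has_prod_unique by metis
  have "fps_X ^ N dvd prodinf f - (\<Prod>i<Suc (Suc N). f i)"
    unfolding fps_X_power_dvd_iff using fp[of _ "Suc (Suc N)"] eq by simp
  moreover have "fps_X ^ N dvd (\<Prod>i<Suc (Suc N). f i) - (\<Prod>i<N. f i)"
    by (rule fps_partial_prod_mod[OF f]) simp
  ultimately show ?thesis by (rule dvd_diff_trans)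
qed

section \<open>The Jacobi triple product, finite and infinite\<close>

fun gauss_binomial :: "'a::comm_ring_1 \<Rightarrow> nat \<Rightarrow> nat \<Rightarrow> 'a" where
  "gauss_binomial y n 0 = 1"
| "gauss_binomial y 0 (Suc k) = 0"
| "gauss_binomial y (Suc n) (Suc k) = gauss_binomial y n k + y ^ Suc k * gauss_binomial y n (Suc k)"

lemma gauss_binomial_eq_0: "n < k \<Longrightarrow> gauss_binomial y n k = 0"
  by (induction y n k rule: gauss_binomial.induct) auto

text \<open>
  The second Pascal rule. The defining rule raises \<open>N\<close>, and this one raises \<open>M\<close>, in
  the induction for the finite Jacobi triple product below.
\<close>

lemma gauss_binomial_Suc_Suc':
  "k \<le> n \<Longrightarrow> gauss_binomial y (Suc n) (Suc k) =
     gauss_binomial y n (Suc k) + y ^ (n - k) * gauss_binomial y n k"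
proof (induction n arbitrary: k)
  case (Suc n)
  show ?case
  proof (cases k)
    case 0
    have "gauss_binomial y (Suc (Suc n)) (Suc 0) = 1 + y * gauss_binomial y (Suc n) (Suc 0)"
      by simp
    also have "gauss_binomial y (Suc n) (Suc 0) = gauss_binomial y n (Suc 0) + y ^ n"
      using Suc.IH[of 0] by simp
    finally show ?thesis using 0 by (simp add: algebra_simps)
  next
    case k: (Suc j)
    have j: "j \<le> n" using Suc.prems k by simp
    have A: "gauss_binomial y (Suc n) (Suc j) = gauss_binomial y n (Suc j) + y ^ (n - j) * gauss_binomial y n j"
      using Suc.IH[OF j] .
    have B: "y ^ Suc k * gauss_binomial y (Suc n) (Suc k) =
       y ^ Suc k * gauss_binomial y n (Suc k) + y ^ (n - j) * (y ^ k * gauss_binomial y n k)"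
    proof (cases "k \<le> n")
      case True
      have e: "n - j = Suc (n - k)" using True k by simp
      show ?thesis unfolding Suc.IH[OF True] e by (simp add: algebra_simps)
    next
      case False
      then show ?thesis by (simp add: gauss_binomial_eq_0)
    qed
    have "gauss_binomial y (Suc (Suc n)) (Suc k) =
      gauss_binomial y (Suc n) (Suc j) + y ^ Suc k * gauss_binomial y (Suc n) (Suc k)"
      by (simp add: k)
    also have "\<dots> = (gauss_binomial y n k + y ^ Suc k * gauss_binomial y n (Suc k))
        + y ^ (n - j) * (gauss_binomial y n j + y ^ k * gauss_binomial y n k)"
      unfolding A B by (simp add: algebra_simps k)
    finally show ?thesis by (simp add: k)
  qed
qed simp

text \<open>
  The finite product \<open>(y; y)\<^sub>n\<close>, that is, the \<open>q\<close>-factorial without its usual denominator \<open>(1 - y)\<^sup>n\<close>.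
\<close>

definition qfact :: "'a::comm_ring_1 \<Rightarrow> nat \<Rightarrow> 'a" where
  "qfact y n = (\<Prod>i<n. 1 - y ^ Suc i)"

lemma qfact_Suc: "qfact y (Suc n) = qfact y n * (1 - y ^ Suc n)"
  by (simp add: qfact_def)

lemma gauss_binomial_qfact:
  "k \<le> n \<Longrightarrow> gauss_binomial y n k * qfact y k * qfact y (n - k) = qfact y n"
proof (induction n arbitrary: k)
  case 0
  then show ?case by (simp add: qfact_def)
next
  case (Suc n)
  show ?case
  proof (cases k)
    case 0
    then show ?thesis by (simp add: qfact_def)
  next
    case k: (Suc j)
    have j: "j \<le> n" using Suc.prems k by simp
    have A: "gauss_binomial y n j * qfact y k * qfact y (n - j) = qfact y n * (1 - y ^ Suc j)"
      unfolding k qfact_Suc Suc.IH[OF j, symmetric] by (simp add: algebra_simps)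
    have B: "gauss_binomial y n k * qfact y k * qfact y (n - j) = qfact y n * (1 - y ^ (n - j))"
    proof (cases "k \<le> n")
      case True
      have e: "n - j = Suc (n - k)" using True k by simp
      show ?thesis unfolding e qfact_Suc Suc.IH[OF True, symmetric] by (simp add: algebra_simps)
    next
      case False
      then have "n = j" using j k by simp
      then show ?thesis by (simp add: gauss_binomial_eq_0 k)
    qed
    have "gauss_binomial y (Suc n) k * qfact y k * qfact y (Suc n - k) =
       gauss_binomial y n j * qfact y k * qfact y (n - j)
       + y ^ Suc j * (gauss_binomial y n k * qfact y k * qfact y (n - j))"
      by (simp add: k algebra_simps)
    also have "\<dots> = qfact y n * (1 - y ^ Suc j * y ^ (n - j))"
      unfolding A B by (simp add: algebra_simps)
    also have "y ^ Suc j * y ^ (n - j) = y ^ Suc n"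
      unfolding power_add[symmetric] using j by simp
    finally show ?thesis by (simp add: qfact_Suc)
  qed
qed

definition alt_sign :: "int \<Rightarrow> 'a::comm_ring_1" where
  "alt_sign m = (if even m then 1 else - 1)"

lemma alt_sign_minus: "alt_sign (- m) = alt_sign m"
  by (simp add: alt_sign_def)

text \<open>
  For \<open>u = q\<^sup>a\<close> and base \<open>y = q\<^bsup>a+b\<^esup>\<close> this is the exponent of \<open>q\<close> in
  \<open>y\<^bsup>m(m-1)/2\<^esup> u\<^sup>m\<close>, the general term of the Jacobi triple product. Splitting it into two triangular
  numbers makes it visibly a natural number, also for negative \<open>m\<close>.
\<close>

definition theta_exp :: "nat \<Rightarrow> nat \<Rightarrow> int \<Rightarrow> nat" where
  "theta_exp a b m = a * nat (m * (m + 1) div 2) + b * nat (m * (m - 1) div 2)"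

lemma triangle_nonneg: "0 \<le> m * (m + 1) div 2" "0 \<le> m * (m - 1) div (2::int)"
proof -
  have "0 \<le> m * (m + 1)" by (cases "m \<ge> 0") (auto intro: mult_nonpos_nonpos)
  then show "0 \<le> m * (m + 1) div 2" by simp
  have "0 \<le> m * (m - 1)" by (cases "m \<ge> 1") (auto intro: mult_nonpos_nonpos)
  then show "0 \<le> m * (m - 1) div 2" by simp
qed

lemma two_theta_exp:
  "2 * int (theta_exp a b m) = int a * (m * (m + 1)) + int b * (m * (m - 1))"
proof -
  have "2 * (m * (m + 1) div 2) = m * (m + 1)" "2 * (m * (m - 1) div 2) = m * (m - 1)"
    by (intro dvd_mult_div_cancel; simp)+
  moreover have "2 * int (theta_exp a b m) =
      int a * (2 * (m * (m + 1) div 2)) + int b * (2 * (m * (m - 1) div 2))"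
    unfolding theta_exp_def of_nat_add of_nat_mult nat_0_le[OF triangle_nonneg(1)]
      nat_0_le[OF triangle_nonneg(2)]
    by (simp only: distrib_left mult.left_commute[of 2])
  ultimately show ?thesis by simp
qed

lemma theta_exp_shift_up:
  assumes "m \<le> int M"
  shows "theta_exp a b m + (a + (a + b) * M) = theta_exp a b (m + 1) + (a + b) * nat (int M - m)"
proof -
  have "2 * int (theta_exp a b m + (a + (a + b) * M)) =
        2 * int (theta_exp a b (m + 1) + (a + b) * nat (int M - m))"
    using assms two_theta_exp[of a b m] two_theta_exp[of a b "m + 1"]
    by (simp add: algebra_simps)
  then show ?thesis by (simp only: mult_cancel_left of_nat_eq_iff) simp
qed

lemma theta_exp_shift_down:
  assumes "- int N \<le> m"
  shows "theta_exp a b m + (b + (a + b) * N) = theta_exp a b (m - 1) + (a + b) * nat (int N + m)"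
proof -
  have "2 * int (theta_exp a b m + (b + (a + b) * N)) =
        2 * int (theta_exp a b (m - 1) + (a + b) * nat (int N + m))"
    using assms two_theta_exp[of a b m] two_theta_exp[of a b "m - 1"]
    by (simp add: algebra_simps)
  then show ?thesis by (simp only: mult_cancel_left of_nat_eq_iff) simp
qed

text \<open>
  This bounds the indices \<open>m\<close> that contribute to a given power of \<open>q\<close>.
\<close>

lemma theta_exp_bound:
  assumes "a + b > 0"
  shows "\<bar>m\<bar> \<le> int (theta_exp a b m) + 1"
proof -
  have t: "\<bar>m\<bar> - 1 \<le> m * (m + 1) div 2" "\<bar>m\<bar> - 1 \<le> m * (m - 1) div 2"
  proof -
    have "0 \<le> (\<bar>m\<bar> - 1) * (\<bar>m\<bar> - 2)"
      by (cases "\<bar>m\<bar> \<ge> 2") (auto intro: mult_nonneg_nonneg mult_nonpos_nonpos)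
    then have "2 * (\<bar>m\<bar> - 1) \<le> \<bar>m\<bar> * (\<bar>m\<bar> - 1)" by (simp add: algebra_simps)
    moreover have "\<bar>m\<bar> * (\<bar>m\<bar> - 1) \<le> m * (m + 1)" "\<bar>m\<bar> * (\<bar>m\<bar> - 1) \<le> m * (m - 1)"
      by (auto simp: abs_if algebra_simps)
    ultimately show "\<bar>m\<bar> - 1 \<le> m * (m + 1) div 2" "\<bar>m\<bar> - 1 \<le> m * (m - 1) div 2" by auto
  qed
  have *: "x \<le> int n * x" if "n > 0" "x \<ge> 0" for n :: nat and x :: int
    using mult_right_mono[of 1 "int n" x] that by simp
  have e: "int (theta_exp a b m) = int a * (m * (m + 1) div 2) + int b * (m * (m - 1) div 2)"
    unfolding theta_exp_def using triangle_nonneg[of m] by simp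
  have nn: "0 \<le> int a * (m * (m + 1) div 2)" "0 \<le> int b * (m * (m - 1) div 2)"
    using triangle_nonneg[of m] by simp_all
  show ?thesis
  proof (cases "a > 0")
    case True
    from *[OF this triangle_nonneg(1)[of m]] nn t(1) e show ?thesis by linarith
  next
    case False
    with assms have "b > 0" by simp
    from *[OF this triangle_nonneg(2)[of m]] nn t(2) e show ?thesis by linarith
  qed
qed

text \<open>
  Both sides are multiplied by \<open>1 - x\<^sup>a y\<^sup>M\<close> when \<open>M\<close> grows and by \<open>1 - x\<^sup>b y\<^sup>N\<close> when \<open>N\<close> grows, where
  \<open>y = x\<^bsup>a+b\<^esup>\<close>: multiplication by \<open>x\<^sup>a\<close> shifts the summation index \<open>m = k - N\<close> up and multiplication by
  \<open>x\<^sup>b\<close> shifts it down, and the powers of \<open>y\<close> left over are those in the two Pascal rules.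
\<close>

lemma finite_jacobi_triple:
  fixes x :: "'a::comm_ring_1"
  shows "(\<Prod>i<M. 1 - x ^ a * (x ^ (a + b)) ^ i) * (\<Prod>i<N. 1 - x ^ b * (x ^ (a + b)) ^ i) =
   (\<Sum>k\<le>M + N. alt_sign (int k - int N) * gauss_binomial (x ^ (a + b)) (M + N) k
                  * x ^ theta_exp a b (int k - int N))"
proof -
  define y where "y = x ^ (a + b)"
  define e where "e = theta_exp a b"
  define S where "S = (\<lambda>M N. \<Sum>k\<le>M + N. alt_sign (int k - int N) * gauss_binomial y (M + N) k
                  * x ^ e (int k - int N))"
  have ypow: "y ^ i = x ^ ((a + b) * i)" for i by (simp add: y_def power_mult)
  have S_M: "S (Suc M) N = S M N * (1 - x ^ a * y ^ M)" for M N
  proof -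
    define t where "t = (\<lambda>k. alt_sign (int k - int N) * gauss_binomial y (M + N) k * x ^ e (int k - int N))"
    have step: "alt_sign (int (Suc k) - int N) * gauss_binomial y (Suc (M + N)) (Suc k) * x ^ e (int (Suc k) - int N)
      = t (Suc k) - t k * (x ^ a * y ^ M)" if "k \<le> M + N" for k
    proof -
      have "x ^ e (int k - int N) * (x ^ a * y ^ M) = x ^ (e (int k - int N) + (a + (a + b) * M))"
        by (simp add: ypow power_add)
      also have "\<dots> = x ^ (e (int k - int N + 1) + (a + b) * nat (int M - (int k - int N)))"
        unfolding e_def using that by (subst theta_exp_shift_up) auto
      also have "int k - int N + 1 = int (Suc k) - int N" by simp
      also have "nat (int M - (int k - int N)) = M + N - k" using that by auto
      finally have E: "x ^ e (int k - int N) * (x ^ a * y ^ M) = x ^ e (int (Suc k) - int N) * y ^ (M + N - k)"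
        by (simp add: ypow power_add)
      have s: "alt_sign (int k - int N) = (- alt_sign (int (Suc k) - int N) :: 'a)"
        by (auto simp: alt_sign_def)
      have "t k * (x ^ a * y ^ M) = alt_sign (int k - int N) * gauss_binomial y (M + N) k * (x ^ e (int k - int N) * (x ^ a * y ^ M))"
        by (simp add: t_def mult_ac)
      then have "t k * (x ^ a * y ^ M) = - alt_sign (int (Suc k) - int N) * gauss_binomial y (M + N) k * (x ^ e (int (Suc k) - int N) * y ^ (M + N - k))"
        unfolding E s .
      then show ?thesis
        unfolding gauss_binomial_Suc_Suc'[OF that] t_def by (simp add: algebra_simps)
    qed
    have "S (Suc M) N = t 0 + (\<Sum>k\<le>M + N. t (Suc k) - t k * (x ^ a * y ^ M))"
      unfolding S_def add_Suc sum.atMost_Suc_shift using step by (simp add: t_def)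
    also have "\<dots> = (\<Sum>k\<le>Suc (M + N). t k) - (\<Sum>k\<le>M + N. t k) * (x ^ a * y ^ M)"
      unfolding sum.atMost_Suc_shift by (simp add: sum_subtractf sum_distrib_right)
    also have "(\<Sum>k\<le>Suc (M + N). t k) = (\<Sum>k\<le>M + N. t k)"
      by (simp add: t_def gauss_binomial_eq_0)
    finally show ?thesis by (simp add: S_def t_def algebra_simps)
  qed
  have S_N: "S M (Suc N) = S M N * (1 - x ^ b * y ^ N)" for M N
  proof -
    define t where "t = (\<lambda>k. alt_sign (int k - int N) * gauss_binomial y (M + N) k * x ^ e (int k - int N))"
    define r where "r = (\<lambda>k. t k * (x ^ b * y ^ N))"
    have R: "r k = - alt_sign (int k - int (Suc N)) * y ^ k * gauss_binomial y (M + N) k * x ^ e (int k - int (Suc N)) * 1" for k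
    proof -
      have "x ^ e (int k - int N) * (x ^ b * y ^ N) = x ^ (e (int k - int N) + (b + (a + b) * N))"
        by (simp add: ypow power_add)
      also have "\<dots> = x ^ (e (int k - int N - 1) + (a + b) * nat (int N + (int k - int N)))"
        unfolding e_def by (subst theta_exp_shift_down) auto
      also have "int k - int N - 1 = int k - int (Suc N)" by simp
      also have "nat (int N + (int k - int N)) = k" by auto
      finally have E: "x ^ e (int k - int N) * (x ^ b * y ^ N) = x ^ e (int k - int (Suc N)) * y ^ k"
        by (simp add: ypow power_add)
      have s: "alt_sign (int k - int N) = (- alt_sign (int k - int (Suc N)) :: 'a)"
        by (auto simp: alt_sign_def)
      have "r k = alt_sign (int k - int N) * gauss_binomial y (M + N) k * (x ^ e (int k - int N) * (x ^ b * y ^ N))"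
        by (simp add: r_def t_def mult_ac)
      then show ?thesis unfolding E s by (simp add: mult_ac)
    qed
    have step: "alt_sign (int (Suc k) - int (Suc N)) * gauss_binomial y (Suc (M + N)) (Suc k) * x ^ e (int (Suc k) - int (Suc N))
      = t k - r (Suc k)" for k
      unfolding R t_def by (simp add: algebra_simps)
    have "S M (Suc N) = - r 0 + (\<Sum>k\<le>M + N. t k - r (Suc k))"
      unfolding S_def add_Suc_right sum.atMost_Suc_shift step by (simp add: R)
    also have "\<dots> = (\<Sum>k\<le>M + N. t k) - (\<Sum>k\<le>Suc (M + N). r k)"
      unfolding sum.atMost_Suc_shift by (simp add: sum_subtractf)
    also have "(\<Sum>k\<le>Suc (M + N). r k) = (\<Sum>k\<le>M + N. r k)"
      by (simp add: r_def t_def gauss_binomial_eq_0)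
    also have "\<dots> = (\<Sum>k\<le>M + N. t k) * (x ^ b * y ^ N)" by (simp add: r_def sum_distrib_right)
    finally show ?thesis by (simp add: S_def t_def algebra_simps)
  qed
  have "S M 0 = (\<Prod>i<M. 1 - x ^ a * y ^ i)" for M
  proof (induction M)
    case 0
    then show ?case by (simp add: S_def alt_sign_def e_def theta_exp_def)
  qed (simp add: S_M)
  then have "S M N = (\<Prod>i<M. 1 - x ^ a * y ^ i) * (\<Prod>i<N. 1 - x ^ b * y ^ i)"
    by (induction N) (simp_all add: S_N mult.assoc)
  then show ?thesis by (simp add: S_def y_def e_def)
qed

lemma theta_factor_mod:
  assumes "d > 0"
  shows "fps_X ^ i dvd (1 - fps_X ^ a * (fps_X ^ d) ^ i) - (1 :: complex fps)"
proof -
  have "fps_X ^ i dvd (fps_X :: complex fps) ^ (a + d * i)"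
    by (rule le_imp_power_dvd) (use assms in \<open>simp add: trans_le_add2\<close>)
  moreover have "(1 - fps_X ^ a * (fps_X ^ d) ^ i) - (1 :: complex fps) = - (fps_X ^ (a + d * i))"
    by (simp add: power_add power_mult)
  ultimately show ?thesis by (simp only: dvd_minus_iff)
qed

lemma qpoch_mod:
  assumes "d > 0"
  shows "fps_X ^ N dvd qpoch (map (\<lambda>a. fps_X ^ a) as) (fps_X ^ d)
           - (\<Prod>i<N. \<Prod>a\<leftarrow>as. 1 - fps_X ^ a * (fps_X ^ d) ^ i)"
proof -
  have "fps_X ^ i dvd (\<Prod>a\<leftarrow>as. 1 - fps_X ^ a * (fps_X ^ d) ^ i) - (1 :: complex fps)" for i
  proof (induction as)
    case (Cons a as)
    from dvd_diff_mult[OF theta_factor_mod[OF assms, of i a] Cons] show ?case by simp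
  qed simp
  from fps_prodinf_mod[OF this] show ?thesis by (simp add: qpoch_def o_def)
qed

lemma fps_X_power_dvd_cancel:
  fixes f u :: "'a::field fps"
  assumes "fps_X ^ n dvd f * u" "fps_nth u 0 \<noteq> 0"
  shows "fps_X ^ n dvd f"
  using assms by (simp add: dvd_mult_unit_iff)

text \<open>
  The quotient \<open>(y)\<^sub>N (y)\<^bsub>2N\<^esub> / ((y)\<^sub>k (y)\<^bsub>2N-k\<^esub>)\<close> tends to \<open>1\<close>: all four factors agree
  with \<open>(y)\<^sub>L\<close> modulo \<open>X\<^sup>L\<close>, and \<open>(y)\<^sub>L\<close> is a unit. This is what turns the finite identity into the
  infinite one.
\<close>

lemma qfact_gauss_binomial_mod:
  assumes "d > 0" "L \<le> k" "k + L \<le> 2 * N" "L \<le> N"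
  shows "fps_X ^ L dvd qfact (fps_X ^ d) N * gauss_binomial (fps_X ^ d) (2 * N) k - (1 :: complex fps)"
proof -
  define y :: "complex fps" where "y = fps_X ^ d"
  have q: "fps_X ^ L dvd qfact y j - qfact y L" if "L \<le> j" for j
    unfolding qfact_def
  proof (rule fps_partial_prod_mod[OF _ that])
    fix i show "fps_X ^ i dvd 1 - y ^ Suc i - 1"
      using theta_factor_mod[OF assms(1), of i d] by (simp add: y_def)
  qed
  have u: "fps_nth (qfact y L) 0 \<noteq> 0"
    using assms(1) by (induction L) (auto simp: qfact_def y_def power_mult[symmetric] simp del: power_Suc)
  let ?T = "qfact y N * gauss_binomial y (2 * N) k"
  have "k \<le> 2 * N" using assms by linarith
  then have eq: "?T * (qfact y k * qfact y (2 * N - k)) = qfact y N * qfact y (2 * N)"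
    using gauss_binomial_qfact[of k "2 * N" y] by (simp add: mult_ac)
  have 1: "fps_X ^ L dvd qfact y k * qfact y (2 * N - k) - qfact y L * qfact y L"
    by (intro dvd_diff_mult q) (use assms in auto)
  have 2: "fps_X ^ L dvd qfact y N * qfact y (2 * N) - qfact y L * qfact y L"
    by (intro dvd_diff_mult q) (use assms in auto)
  have "fps_X ^ L dvd ?T * (qfact y k * qfact y (2 * N - k)) - ?T * (qfact y L * qfact y L)"
    using 1 by (simp add: right_diff_distrib[symmetric])
  then have "fps_X ^ L dvd qfact y L * qfact y L - ?T * (qfact y L * qfact y L)"
    unfolding eq using 2 by (metis dvd_diff_trans dvd_diff_commute)
  then have "fps_X ^ L dvd (?T - 1) * (qfact y L * qfact y L)"
    by (subst (asm) dvd_diff_commute) (simp add: algebra_simps)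
  then show ?thesis unfolding y_def[symmetric]
    by (rule fps_X_power_dvd_cancel) (use u in simp)
qed

text \<open>
  The coefficient of \<open>X\<^sup>K\<close> is read off from the finite identity with \<open>M = N = 2 K + 2\<close>. The indices \<open>m\<close>
  with exponent at most \<open>K\<close> satisfy \<open>\<bar>m\<bar> \<le> K + 1\<close>, hence stay at distance more than \<open>K\<close> from the ends
  \<open>- N\<close> and \<open>N\<close> of the sum, where the Gaussian binomial is not yet close to its limit.
\<close>

theorem jacobi_triple_product_nth:
  assumes ab: "a + b > 0"
  shows "fps_nth (qpoch [fps_X ^ a, fps_X ^ b, fps_X ^ (a + b)] (fps_X ^ (a + b))) K =
           (\<Sum>m | theta_exp a b m = K. alt_sign m)"
proof -
  define y :: "complex fps" where "y = fps_X ^ (a + b)"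
  define e where "e = theta_exp a b"
  define N where "N = 2 * K + 2"
  have "fps_X ^ N dvd qpoch [fps_X ^ a, fps_X ^ b, y] y
      - (\<Prod>i<N. (1 - fps_X ^ a * y ^ i) * ((1 - fps_X ^ b * y ^ i) * (1 - y * y ^ i)))"
    using qpoch_mod[of "a + b" N "[a, b, a + b]"] ab by (simp add: y_def mult.assoc)
  also have "(\<Prod>i<N. (1 - fps_X ^ a * y ^ i) * ((1 - fps_X ^ b * y ^ i) * (1 - y * y ^ i))) =
     ((\<Prod>i<N. 1 - fps_X ^ a * y ^ i) * (\<Prod>i<N. 1 - fps_X ^ b * y ^ i)) * qfact y N"
    by (simp add: prod.distrib qfact_def mult.assoc)
  also have "\<dots> = (\<Sum>k\<le>2 * N. fps_X ^ e (int k - int N) * (alt_sign (int k - int N) * (qfact y N * gauss_binomial y (2 * N) k)))"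
    unfolding y_def e_def finite_jacobi_triple mult_2 sum_distrib_right by (simp only: mult_ac)
  finally have "fps_nth (qpoch [fps_X ^ a, fps_X ^ b, y] y) K =
     (\<Sum>k\<le>2 * N. fps_nth (fps_X ^ e (int k - int N) * (alt_sign (int k - int N) * (qfact y N * gauss_binomial y (2 * N) k))) K)"
    unfolding fps_X_power_dvd_iff by (simp add: N_def fps_sum_nth)
  also have "\<dots> = (\<Sum>k\<le>2 * N. if e (int k - int N) = K then alt_sign (int k - int N) else 0)"
  proof (rule sum.cong)
    fix k assume "k \<in> {..2 * N}"
    show "fps_nth (fps_X ^ e (int k - int N) * (alt_sign (int k - int N) * (qfact y N * gauss_binomial y (2 * N) k))) K
       = (if e (int k - int N) = K then alt_sign (int k - int N) else 0)"
    proof (cases "e (int k - int N) \<le> K")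
      case False
      then show ?thesis by (simp add: fps_X_power_mult_nth)
    next
      case True
      have "\<bar>int k - int N\<bar> \<le> int K + 1"
        using theta_exp_bound[OF ab, of "int k - int N"] True by (simp add: e_def)
      then have "fps_X ^ Suc K dvd qfact y N * gauss_binomial y (2 * N) k - 1"
        unfolding y_def by (intro qfact_gauss_binomial_mod ab) (auto simp: N_def)
      then have "fps_nth (qfact y N * gauss_binomial y (2 * N) k) j = fps_nth 1 j" if "j \<le> K" for j
        using that unfolding fps_X_power_dvd_iff by simp
      from this[of "K - e (int k - int N)"] True show ?thesis
        by (cases "K = e (int k - int N)")
           (auto simp: fps_X_power_mult_nth alt_sign_def simp del: fps_mult_nth_0)
    qed
  qed simp
  also have "\<dots> = (\<Sum>k | k \<le> 2 * N \<and> e (int k - int N) = K. alt_sign (int k - int N))"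
    by (subst sum.If_cases) (auto intro!: sum.cong)
  also have "\<dots> = (\<Sum>m | e m = K. alt_sign m)"
  proof (rule sum.reindex_bij_witness[of _ "\<lambda>m. nat (m + int N)" "\<lambda>k. int k - int N"])
    fix m assume m: "m \<in> {m. e m = K}"
    have "\<bar>m\<bar> \<le> int K + 1" using theta_exp_bound[OF ab, of m] m by (simp add: e_def)
    then show "int (nat (m + int N)) - int N = m" "nat (m + int N) \<in> {k. k \<le> 2 * N \<and> e (int k - int N) = K}"
      using m by (auto simp: N_def)
  qed auto
  finally show ?thesis by (simp add: y_def e_def)
qed

section \<open>Sums of monomials with rational exponents\<close>

text \<open>
  Theta series are treated as sums \<open>\<Sum>i\<in>I. c i q\<^bsup>e i\<^esup>\<close> over an arbitrary index set. Keeping the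
  index set explicit lets rearrangements of series be expressed by bijections and
  disjoint unions of index sets.
\<close>

definition locally_finite :: "'i set \<Rightarrow> ('i \<Rightarrow> rat) \<Rightarrow> bool" where
  "locally_finite I e \<longleftrightarrow> (\<forall>x. finite {i \<in> I. e i \<le> x})"

definition qsum :: "'i set \<Rightarrow> ('i \<Rightarrow> 'a::comm_ring_1) \<Rightarrow> ('i \<Rightarrow> rat) \<Rightarrow> 'a qseries" where
  "qsum I c e = Abs_qseries (\<lambda>x. \<Sum>i | i \<in> I \<and> e i = x. c i)"

lemma locally_finite_fibre: "locally_finite I e \<Longrightarrow> finite {i. i \<in> I \<and> e i = x}"
  unfolding locally_finite_def by (rule finite_subset[of _ "{i \<in> I. e i \<le> x}"]) auto

lemma locally_finite_subset:
  assumes "locally_finite I e" "J \<subseteq> I"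
  shows   "locally_finite J e"
  unfolding locally_finite_def
proof
  fix x
  show "finite {j \<in> J. e j \<le> x}"
    by (rule finite_subset[of _ "{i \<in> I. e i \<le> x}"])
       (use assms in \<open>auto simp: locally_finite_def\<close>)
qed

lemma locally_finite_reindex:
  assumes "locally_finite I e" "inj_on h J" "h ` J \<subseteq> I"
  shows   "locally_finite J (\<lambda>j. e (h j))"
  unfolding locally_finite_def
proof
  fix x
  show "finite {j \<in> J. e (h j) \<le> x}"
  proof (rule finite_imageD)
    show "finite (h ` {j \<in> J. e (h j) \<le> x})"
      by (rule finite_subset[of _ "{i \<in> I. e i \<le> x}"])
         (use assms(1,3) in \<open>auto simp: locally_finite_def\<close>)
    show "inj_on h {j \<in> J. e (h j) \<le> x}" using assms(2) by (rule inj_on_subset) auto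
  qed
qed

lemma locally_finite_bounded_below:
  assumes "locally_finite I e"
  obtains m where "\<And>i. i \<in> I \<Longrightarrow> m \<le> e i"
proof (cases "I = {}")
  case False
  then obtain j where j: "j \<in> I" by blast
  let ?S = "e ` {i \<in> I. e i \<le> e j}"
  have fin: "finite ?S" using assms by (auto simp: locally_finite_def)
  have "Min ?S \<le> e i" if "i \<in> I" for i
  proof (cases "e i \<le> e j")
    case True
    with that fin show ?thesis by (intro Min_le) auto
  next
    case False
    have "Min ?S \<le> e j" using fin j by (intro Min_le) auto
    with False show ?thesis by linarith
  qed
  then show ?thesis using that by blast
qed (use that in blast)

lemma locally_finite_sum:
  assumes I: "locally_finite I e" and J: "locally_finite J f"
  shows   "locally_finite (I \<times> J) (\<lambda>(i, j). e i + f j)"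
  unfolding locally_finite_def
proof
  fix x
  obtain m where m: "\<And>i. i \<in> I \<Longrightarrow> m \<le> e i" using locally_finite_bounded_below[OF I] by blast
  obtain k where k: "\<And>j. j \<in> J \<Longrightarrow> k \<le> f j" using locally_finite_bounded_below[OF J] by blast
  have "{p \<in> I \<times> J. (case p of (i, j) \<Rightarrow> e i + f j) \<le> x} \<subseteq>
        {i \<in> I. e i \<le> x - k} \<times> {j \<in> J. f j \<le> x - m}"
    using m k by (force simp: algebra_simps)
  then show "finite {p \<in> I \<times> J. (case p of (i, j) \<Rightarrow> e i + f j) \<le> x}"
    using I J unfolding locally_finite_def by (elim finite_subset) auto
qed

lemma qcoeff_qsum:
  assumes "locally_finite I e"
  shows   "qcoeff (qsum I c e) x = (\<Sum>i | i \<in> I \<and> e i = x. c i)"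
proof -
  have "left_finite (\<lambda>x. \<Sum>i | i \<in> I \<and> e i = x. c i)"
    unfolding left_finite_def
  proof
    fix x
    have "{y. y \<le> x \<and> (\<Sum>i | i \<in> I \<and> e i = y. c i) \<noteq> 0} \<subseteq> e ` {i \<in> I. e i \<le> x}"
    proof
      fix y assume y: "y \<in> {y. y \<le> x \<and> (\<Sum>i | i \<in> I \<and> e i = y. c i) \<noteq> 0}"
      then obtain i where "i \<in> {i. i \<in> I \<and> e i = y}"
        using sum.neutral[of "{i. i \<in> I \<and> e i = y}" c] by blast
      then show "y \<in> e ` {i \<in> I. e i \<le> x}" using y by auto
    qed
    then show "finite {y. y \<le> x \<and> (\<Sum>i | i \<in> I \<and> e i = y. c i) \<noteq> 0}"
      using assms unfolding locally_finite_def by (meson finite_imageI finite_subset)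
  qed
  then show ?thesis by (simp add: qsum_def Abs_qseries_inverse)
qed

lemma qcoeff_qsum_nonzeroE:
  assumes "locally_finite I e" "qcoeff (qsum I c e) x \<noteq> 0"
  obtains i where "i \<in> I" "e i = x"
proof -
  have "{i. i \<in> I \<and> e i = x} \<noteq> {}"
    using assms(2) unfolding qcoeff_qsum[OF assms(1)] by (metis sum.empty)
  then show ?thesis using that by blast
qed

lemma formal_sum_qpow:
  assumes "locally_finite UNIV e"
  shows   "formal_sum (\<lambda>i. qpow (e i)) = (qsum UNIV (\<lambda>_. 1) e :: 'a::comm_ring_1 qseries)"
proof -
  have "Sum_any (\<lambda>i. qcoeff (qpow (e i) :: 'a qseries) x) = (\<Sum>i | i \<in> UNIV \<and> e i = x. 1)" for x
  proof -
    have "Sum_any (\<lambda>i. qcoeff (qpow (e i) :: 'a qseries) x) =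
            (\<Sum>i | i \<in> UNIV \<and> e i = x. qcoeff (qpow (e i) :: 'a qseries) x)"
      by (rule Sum_any.expand_superset[OF locally_finite_fibre[OF assms]])
         (auto simp: qcoeff_qpow split: if_splits)
    also have "\<dots> = (\<Sum>i | i \<in> UNIV \<and> e i = x. 1)"
      by (intro sum.cong) (auto simp: qcoeff_qpow)
    finally show ?thesis .
  qed
  then show ?thesis unfolding formal_sum_def qsum_def by simp
qed

lemma qsum_cong:
  assumes "I = J" "\<And>i. i \<in> J \<Longrightarrow> c i = d i" "\<And>i. i \<in> J \<Longrightarrow> e i = f i"
  shows   "qsum I c e = qsum J d f"
  unfolding qsum_def using assms
  by (intro arg_cong[where f = Abs_qseries] ext sum.cong) auto

lemma qsum_reindex:
  assumes "bij_betw h J I"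
  shows   "qsum I c e = qsum J (\<lambda>j. c (h j)) (\<lambda>j. e (h j))"
  unfolding qsum_def
proof (intro arg_cong[where f = Abs_qseries] ext)
  fix x
  have "bij_betw h {j. j \<in> J \<and> e (h j) = x} {i. i \<in> I \<and> e i = x}"
    using assms unfolding bij_betw_def by (auto intro: inj_on_subset)
  then show "(\<Sum>i | i \<in> I \<and> e i = x. c i) = (\<Sum>j | j \<in> J \<and> e (h j) = x. c (h j))"
    by (rule sum.reindex_bij_betw[symmetric])
qed

lemma qsum_empty [simp]: "qsum {} c e = 0"
proof (rule qseries_eqI)
  fix x
  have "locally_finite {} e" by (simp add: locally_finite_def)
  then show "qcoeff (qsum {} c e) x = qcoeff 0 x" by (simp add: qcoeff_qsum)
qed

lemma qsum_union:
  assumes "locally_finite (I \<union> J) e" "I \<inter> J = {}"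
  shows   "qsum (I \<union> J) c e = qsum I c e + qsum J c e"
proof (rule qseries_eqI)
  fix x
  have fin: "locally_finite I e" "locally_finite J e"
    by (auto intro: locally_finite_subset[OF assms(1)])
  have "{i. i \<in> I \<union> J \<and> e i = x} = {i. i \<in> I \<and> e i = x} \<union> {i. i \<in> J \<and> e i = x}" by auto
  then show "qcoeff (qsum (I \<union> J) c e) x = qcoeff (qsum I c e + qsum J c e) x"
    using assms(2) fin
    by (simp add: qcoeff_qsum[OF assms(1)] qcoeff_qsum locally_finite_fibre)
       (rule sum.union_disjoint; auto intro: locally_finite_fibre)
qed

lemma qsum_UN:
  assumes "finite K" "locally_finite (\<Union>k\<in>K. I k) e" "disjoint_family_on I K"
  shows   "qsum (\<Union>k\<in>K. I k) c e = (\<Sum>k\<in>K. qsum (I k) c e)"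
  using assms
proof (induction K rule: finite_induct)
  case (insert k K)
  have "qsum (I k \<union> (\<Union>k\<in>K. I k)) c e = qsum (I k) c e + qsum (\<Union>k\<in>K. I k) c e"
    by (rule qsum_union) (use insert in \<open>auto simp: disjoint_family_on_def\<close>)
  also have "qsum (\<Union>k\<in>K. I k) c e = (\<Sum>k\<in>K. qsum (I k) c e)"
    by (rule insert.IH)
       (use insert.prems in \<open>auto intro: locally_finite_subset simp: disjoint_family_on_def\<close>)
  finally show ?case using insert by simp
qed simp

lemma qsum_neg: "locally_finite I e \<Longrightarrow> qsum I (\<lambda>i. - c i) e = - qsum I c e"
  by (rule qseries_eqI) (simp add: qcoeff_qsum sum_negf)

lemma qpow_mult_qsum:
  "locally_finite I e \<Longrightarrow> qpow y * qsum I c e = qsum I c (\<lambda>i. e i + y)"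
proof -
  assume fin: "locally_finite I e"
  have fin': "locally_finite I (\<lambda>i. e i + y)"
    using fin unfolding locally_finite_def by (simp add: le_diff_eq[symmetric])
  show ?thesis
    by (rule qseries_eqI)
       (simp add: qcoeff_qpow_mult qcoeff_qsum[OF fin] qcoeff_qsum[OF fin'] eq_diff_eq)
qed

lemma qsubst_pow_qsum:
  assumes "n > 0" "locally_finite I e"
  shows   "qsubst_pow n (qsum I c e) = qsum I c (\<lambda>i. of_nat n * e i)"
proof -
  have fin': "locally_finite I (\<lambda>i. of_nat n * e i)"
    using assms unfolding locally_finite_def
    by (simp add: pos_le_divide_eq[symmetric] mult.commute[of "of_nat n"])
  show ?thesis
    using assms(1)
    by (intro qseries_eqI)
       (simp add: qsubst_pow.rep_eq qcoeff_qsum[OF assms(2)] qcoeff_qsum[OF fin'] eq_divide_eq mult.commute)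
qed

text \<open>
  The Cauchy product. The exponents of the second factor are bounded below by some \<open>l\<close>, so only the
  finitely many \<open>i\<close> with \<open>e i \<le> x - l\<close> contribute to the coefficient of \<open>q\<^sup>x\<close>.
\<close>

lemma qsum_mult:
  assumes I: "locally_finite I e" and J: "locally_finite J f"
  shows   "qsum I c e * qsum J d f = qsum (I \<times> J) (\<lambda>(i, j). c i * d j) (\<lambda>(i, j). e i + f j)"
proof (rule qseries_eqI)
  fix x
  obtain l where l: "\<And>j. j \<in> J \<Longrightarrow> l \<le> f j" using locally_finite_bounded_below[OF J] by blast
  define I0 where "I0 = {i \<in> I. e i \<le> x - l}"
  have fin: "finite I0" using I by (auto simp: I0_def locally_finite_def)
  have I0: "i \<in> I0" if "i \<in> I" "j \<in> J" "f j = x - e i" for i j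
    using l[OF that(2)] that by (auto simp: I0_def)
  define F where "F = (\<lambda>y. \<Sum>j | j \<in> J \<and> f j = x - y. d j)"
  have "qcoeff (qsum I c e * qsum J d f) x = qconv (qcoeff (qsum I c e)) (qcoeff (qsum J d f)) x"
    by (simp add: times_qseries.rep_eq)
  also have "\<dots> = (\<Sum>a\<in>e ` I0. qcoeff (qsum I c e) a * qcoeff (qsum J d f) (x - a))"
  proof (rule qconv_eq_sum)
    fix a assume a: "qcoeff (qsum I c e) a \<noteq> 0" "qcoeff (qsum J d f) (x - a) \<noteq> 0"
    obtain i where i: "i \<in> I" "e i = a" using qcoeff_qsum_nonzeroE[OF I a(1)] .
    obtain j where j: "j \<in> J" "f j = x - a" using qcoeff_qsum_nonzeroE[OF J a(2)] .
    show "a \<in> e ` I0" using I0[of i j] i j by auto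
  qed (use fin in auto)
  also have "\<dots> = (\<Sum>a\<in>e ` I0. \<Sum>i | i \<in> I0 \<and> e i = a. c i * F (e i))"
  proof (rule sum.cong)
    fix a assume a: "a \<in> e ` I0"
    have "{i. i \<in> I \<and> e i = a} = {i. i \<in> I0 \<and> e i = a}" using a by (auto simp: I0_def)
    then show "qcoeff (qsum I c e) a * qcoeff (qsum J d f) (x - a) = (\<Sum>i | i \<in> I0 \<and> e i = a. c i * F (e i))"
      by (simp add: qcoeff_qsum[OF I] qcoeff_qsum[OF J] F_def sum_distrib_right)
  qed simp
  also have "\<dots> = (\<Sum>i\<in>I0. c i * F (e i))"
    using sum.image_gen[OF fin, of "\<lambda>i. c i * F (e i)" e] by simp
  also have "\<dots> = (\<Sum>i\<in>I0. \<Sum>j | j \<in> J \<and> f j = x - e i. c i * d j)"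
    by (simp add: F_def sum_distrib_left)
  also have "\<dots> = (\<Sum>(i, j)\<in>(SIGMA i:I0. {j. j \<in> J \<and> f j = x - e i}). c i * d j)"
    by (rule sum.Sigma) (use fin locally_finite_fibre[OF J] in auto)
  also have "(SIGMA i:I0. {j. j \<in> J \<and> f j = x - e i}) = {p. p \<in> I \<times> J \<and> (case p of (i, j) \<Rightarrow> e i + f j) = x}"
    using I0 by (auto simp: I0_def algebra_simps)
  finally show "qcoeff (qsum I c e * qsum J d f) x =
      qcoeff (qsum (I \<times> J) (\<lambda>(i, j). c i * d j) (\<lambda>(i, j). e i + f j)) x"
    by (simp add: qcoeff_qsum[OF locally_finite_sum[OF I J]])
qed

lemma qcoeff_qseries_of_fps:
  "qcoeff (qseries_of_fps f) e = (if e \<in> \<nat> then fps_nth f (nat \<lfloor>e\<rfloor>) else 0)"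
  by (simp add: qseries_of_fps.rep_eq)

lemma qseries_of_fps_1: "qseries_of_fps 1 = 1"
  by (rule qseries_eqI)
     (auto simp: qcoeff_qseries_of_fps one_qseries.rep_eq elim!: Nats_cases)

lemma qseries_of_fps_mult:
  "qseries_of_fps (f * g) = qseries_of_fps f * (qseries_of_fps g :: 'a::comm_ring_1 qseries)"
proof (rule qseries_eqI)
  fix x
  have 0: "qcoeff (qseries_of_fps f * (qseries_of_fps g :: 'a qseries)) x =
     qconv (qcoeff (qseries_of_fps f)) (qcoeff (qseries_of_fps g)) x"
    by (simp add: times_qseries.rep_eq)
  show "qcoeff (qseries_of_fps (f * g)) x = qcoeff (qseries_of_fps f * (qseries_of_fps g :: 'a qseries)) x"
  proof (cases "x \<in> \<nat>")
    case True
    then obtain n where n: "x = of_nat n" by (elim Nats_cases)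
    have "qconv (qcoeff (qseries_of_fps f)) (qcoeff (qseries_of_fps g)) x =
        (\<Sum>a\<in>of_nat ` {..n}. qcoeff (qseries_of_fps f) a * qcoeff (qseries_of_fps g) (x - a))"
    proof (rule qconv_eq_sum)
      fix a assume "qcoeff (qseries_of_fps f) a \<noteq> 0" "qcoeff (qseries_of_fps g) (x - a) \<noteq> 0"
      then have "a \<in> \<nat>" "x - a \<in> \<nat>" by (auto simp: qcoeff_qseries_of_fps split: if_splits)
      then obtain i j where "a = of_nat i" "x - a = of_nat j" by (auto elim!: Nats_cases)
      moreover from this have "rat_of_nat n = of_nat (i + j)" by (simp add: n algebra_simps)
      then have "n = i + j" by (simp only: of_nat_eq_iff)
      ultimately show "a \<in> of_nat ` {..n}" by auto
    qed simp
    also have "\<dots> = (\<Sum>i\<le>n. fps_nth f i * fps_nth g (n - i))"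
      by (subst sum.reindex)
         (auto simp: inj_on_def qcoeff_qseries_of_fps n of_nat_diff[symmetric] simp del: of_nat_diff intro!: sum.cong)
    finally show ?thesis unfolding 0
      by (simp add: qcoeff_qseries_of_fps n fps_mult_nth atLeast0AtMost)
  next
    case False
    have "qconv (qcoeff (qseries_of_fps f)) (qcoeff (qseries_of_fps g)) x = (\<Sum>a\<in>{}. qcoeff (qseries_of_fps f) a * qcoeff (qseries_of_fps g) (x - a))"
    proof (rule qconv_eq_sum)
      fix a assume "qcoeff (qseries_of_fps f) a \<noteq> 0" "qcoeff (qseries_of_fps g) (x - a) \<noteq> 0"
      then have "a \<in> \<nat>" "x - a \<in> \<nat>" by (auto simp: qcoeff_qseries_of_fps split: if_splits)
      then have "a + (x - a) \<in> \<nat>" by (rule Nats_add)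
      with False show "a \<in> {}" by simp
    qed simp
    then show ?thesis unfolding 0 using False by (simp add: qcoeff_qseries_of_fps)
  qed
qed

lemma qsubst_pow_mult:
  assumes "n > 0"
  shows "qsubst_pow n (f * g) = qsubst_pow n f * (qsubst_pow n g :: 'a::comm_ring_1 qseries)"
proof (rule qseries_eqI)
  fix x
  have "qcoeff (qsubst_pow n f * qsubst_pow n g) x =
     Sum_any (\<lambda>a. qcoeff f (a / of_nat n) * qcoeff g ((x - a) / of_nat n))"
    using assms by (simp add: times_qseries.rep_eq qconv_def qsubst_pow.rep_eq)
  also have "\<dots> = Sum_any (\<lambda>a. qcoeff f a * qcoeff g (x / of_nat n - a))"
  proof (rule Sum_any.reindex_cong[symmetric])
    show "bij (\<lambda>a. a / rat_of_nat n)"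
      by (rule o_bij[of "\<lambda>a. a * of_nat n"]) (use assms in \<open>auto simp: fun_eq_iff\<close>)
  qed (use assms in \<open>auto simp: diff_divide_distrib\<close>)
  finally show "qcoeff (qsubst_pow n (f * g)) x = qcoeff (qsubst_pow n f * qsubst_pow n g) x"
    using assms by (simp add: times_qseries.rep_eq qconv_def qsubst_pow.rep_eq)
qed

lemma locally_finite_square:
  fixes A B C :: rat
  assumes "A > 0" "C > 0"
  shows   "locally_finite UNIV (\<lambda>j::int. (A * of_int j + B)\<^sup>2 / C)"
  unfolding locally_finite_def
proof
  fix x
  let ?e = "\<lambda>j::int. (A * of_int j + B)\<^sup>2 / C"
  have "finite {(j, e). e \<le> x \<and> qcoeff (qpow (?e j) :: int qseries) e \<noteq> 0}"
    using formally_summable_theta[OF assms] unfolding formally_summable_def by blast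
  moreover have "{j \<in> UNIV. ?e j \<le> x} \<subseteq> fst ` {(j, e). e \<le> x \<and> qcoeff (qpow (?e j) :: int qseries) e \<noteq> 0}"
    by (force simp: qcoeff_qpow)
  ultimately show "finite {j \<in> UNIV. ?e j \<le> x}" by (meson finite_imageI finite_subset)
qed

section \<open>The quintuple product identity\<close>

lemma locally_finite_theta_exp:
  assumes "a + b > 0"
  shows   "locally_finite UNIV (\<lambda>m. of_nat (theta_exp a b m))"
  unfolding locally_finite_def
proof
  fix x :: rat
  have "{m \<in> UNIV. rat_of_nat (theta_exp a b m) \<le> x} \<subseteq> {- (\<lfloor>x\<rfloor> + 1)..\<lfloor>x\<rfloor> + 1}"
  proof
    fix m assume "m \<in> {m \<in> UNIV. rat_of_nat (theta_exp a b m) \<le> x}"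
    then have "int (theta_exp a b m) \<le> \<lfloor>x\<rfloor>" by (simp add: le_floor_iff)
    with theta_exp_bound[OF assms, of m] show "m \<in> {- (\<lfloor>x\<rfloor> + 1)..\<lfloor>x\<rfloor> + 1}" by auto
  qed
  then show "finite {m \<in> UNIV. rat_of_nat (theta_exp a b m) \<le> x}" by (rule finite_subset) simp
qed

theorem jacobi_triple_product:
  assumes "a + b > 0"
  shows   "qseries_of_fps (qpoch [fps_X ^ a, fps_X ^ b, fps_X ^ (a + b)] (fps_X ^ (a + b))) =
           qsum UNIV alt_sign (\<lambda>m. of_nat (theta_exp a b m))"
proof (rule qseries_eqI)
  fix x
  show "qcoeff (qseries_of_fps (qpoch [fps_X ^ a, fps_X ^ b, fps_X ^ (a + b)] (fps_X ^ (a + b)))) x =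
        qcoeff (qsum UNIV alt_sign (\<lambda>m. of_nat (theta_exp a b m))) x"
  proof (cases "x \<in> \<nat>")
    case True
    then obtain K where "x = of_nat K" by (elim Nats_cases)
    then show ?thesis
      by (simp add: qcoeff_qseries_of_fps qcoeff_qsum[OF locally_finite_theta_exp[OF assms]]
            jacobi_triple_product_nth[OF assms])
  next
    case False
    then have "{m. rat_of_nat (theta_exp a b m) = x} = {}" by auto
    with False show ?thesis
      by (simp add: qcoeff_qseries_of_fps qcoeff_qsum[OF locally_finite_theta_exp[OF assms]])
  qed
qed

lemma qpoch_append:
  assumes "d > 0"
  shows "qpoch (map (\<lambda>a. fps_X ^ a) (as @ bs)) (fps_X ^ d) =
         qpoch (map (\<lambda>a. fps_X ^ a) as) (fps_X ^ d) * qpoch (map (\<lambda>a. fps_X ^ a) bs) (fps_X ^ d)"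
proof (rule fps_eqI_mod_X_power)
  fix N
  have "(\<Prod>i<N. \<Prod>a\<leftarrow>as @ bs. 1 - fps_X ^ a * (fps_X ^ d) ^ i) =
      (\<Prod>i<N. \<Prod>a\<leftarrow>as. 1 - fps_X ^ a * (fps_X ^ d) ^ i) *
      (\<Prod>i<N. \<Prod>a\<leftarrow>bs. 1 - fps_X ^ a * (fps_X ^ d :: complex fps) ^ i)"
    by (simp add: prod.distrib)
  with qpoch_mod[OF assms, of N "as @ bs"]
  have "fps_X ^ N dvd qpoch (map (\<lambda>a. fps_X ^ a) (as @ bs)) (fps_X ^ d) -
      (\<Prod>i<N. \<Prod>a\<leftarrow>as. 1 - fps_X ^ a * (fps_X ^ d) ^ i) *
      (\<Prod>i<N. \<Prod>a\<leftarrow>bs. 1 - fps_X ^ a * (fps_X ^ d :: complex fps) ^ i)"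
    by (simp only:)
  then show "fps_X ^ N dvd qpoch (map (\<lambda>a. fps_X ^ a) (as @ bs)) (fps_X ^ d) -
         qpoch (map (\<lambda>a. fps_X ^ a) as) (fps_X ^ d) * qpoch (map (\<lambda>a. fps_X ^ a) bs) (fps_X ^ d)"
    by (rule dvd_diff_trans'[OF _ dvd_diff_mult[OF qpoch_mod[OF assms] qpoch_mod[OF assms]]])
qed

lemma prod_trisect:
  fixes g :: "nat \<Rightarrow> 'a::comm_monoid_mult"
  shows "(\<Prod>i<3 * N. g i) = (\<Prod>i<N. g (3 * i) * (g (3 * i + 1) * g (3 * i + 2)))"
proof (induction N)
  case (Suc N)
  have e: "3 * Suc N = Suc (Suc (Suc (3 * N)))" by simp
  show ?case unfolding e prod.lessThan_Suc Suc.IH by (simp add: mult_ac)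
qed simp

text \<open>
  The factors \<open>1 - q\<^bsup>dj\<^esup>\<close> sorted by \<open>j\<close> modulo \<open>3\<close>.
\<close>

lemma qpoch_trisect:
  assumes "d > 0"
  shows "qpoch [fps_X ^ d, fps_X ^ (2 * d), fps_X ^ (3 * d)] (fps_X ^ (3 * d)) = qpoch [fps_X ^ d] (fps_X ^ d)"
proof (rule fps_eqI_mod_X_power)
  fix N
  let ?X = "fps_X :: complex fps"
  have eq: "(\<Prod>i<N. (1 - ?X ^ d * (?X ^ (3 * d)) ^ i) * ((1 - ?X ^ (2 * d) * (?X ^ (3 * d)) ^ i) *
           (1 - ?X ^ (3 * d) * (?X ^ (3 * d)) ^ i))) = (\<Prod>i<3 * N. 1 - ?X ^ d * (?X ^ d) ^ i)"
    unfolding prod_trisect power_mult[symmetric] power_add[symmetric]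
    by (intro prod.cong refl arg_cong2[where f = "(*)"] arg_cong2[where f = minus] arg_cong2[where f = power])
       (simp_all add: algebra_simps)
  have "?X ^ N dvd qpoch [?X ^ d, ?X ^ (2 * d), ?X ^ (3 * d)] (?X ^ (3 * d)) -
      (\<Prod>i<3 * N. 1 - ?X ^ d * (?X ^ d) ^ i)"
    unfolding eq[symmetric] using qpoch_mod[of "3 * d" N "[d, 2 * d, 3 * d]"] assms by simp
  moreover have "?X ^ N dvd qpoch [?X ^ d] (?X ^ d) - (\<Prod>i<3 * N. 1 - ?X ^ d * (?X ^ d) ^ i)"
    by (rule dvd_trans[OF le_imp_power_dvd]) (use qpoch_mod[OF assms, of "3 * N" "[d]"] in auto)
  ultimately show "?X ^ N dvd qpoch [?X ^ d, ?X ^ (2 * d), ?X ^ (3 * d)] (?X ^ (3 * d)) -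
      qpoch [?X ^ d] (?X ^ d)"
    by (rule dvd_diff_trans')
qed

lemma qpoch_nth_0: "d > 0 \<Longrightarrow> fps_nth (qpoch [fps_X ^ d] (fps_X ^ d)) 0 = 1"
  using qpoch_mod[of d 1 "[d]"] unfolding fps_X_power_dvd_iff by simp

text \<open>
  By trisection \<open>(q\<^sup>d; q\<^sup>d)\<^sub>\<infinity>\<close> is itself a Jacobi triple product, with base \<open>q\<^bsup>3d\<^esup>\<close>.
\<close>

theorem pentagonal_number_theorem:
  assumes "d > 0"
  shows   "qseries_of_fps (qpoch [fps_X ^ d] (fps_X ^ d)) =
           qsum UNIV alt_sign (\<lambda>m. of_nat (theta_exp d (2 * d) m))"
proof -
  have d: "d + 2 * d = 3 * d" by simp
  show ?thesis
    by (rule jacobi_triple_product[of d "2 * d", unfolded d qpoch_trisect[OF assms]])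
       (use assms in simp)
qed

lemma qseries_qpoch_inverse:
  assumes "d > 0"
  shows   "qseries_of_fps (qpoch [fps_X ^ d] (fps_X ^ d)) *
           qseries_of_fps (inverse (qpoch [fps_X ^ d] (fps_X ^ d))) = 1"
  unfolding qseries_of_fps_mult[symmetric]
  by (subst inverse_mult_eq_1') (simp_all add: qpoch_nth_0[OF assms] qseries_of_fps_1)

lemma qsubst_pow_one: "n > 0 \<Longrightarrow> qsubst_pow n 1 = 1"
  by (rule qseries_eqI) (simp add: qsubst_pow.rep_eq one_qseries.rep_eq)

text \<open>
  The substitution is carried out on the pentagonal series of \<open>euler_prod\<close>, where it multiplies every
  exponent by \<open>n\<close>, and then transported to the inverse.
\<close>

lemma qsubst_pow_inverse_euler_prod:
  assumes "n > 0"
  shows   "qsubst_pow n (qseries_of_fps (inverse euler_prod)) =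
           qseries_of_fps (inverse (qpoch [fps_X ^ n] (fps_X ^ n)))"
proof -
  let ?E = "qseries_of_fps (qpoch [fps_X ^ n] (fps_X ^ n))"
  let ?I = "qseries_of_fps (inverse (qpoch [fps_X ^ n] (fps_X ^ n)))"
  have euler: "euler_prod = qpoch [fps_X ^ 1] (fps_X ^ 1)"
    by (simp add: euler_prod_def qpoch_def)
  have "of_nat n * rat_of_nat (theta_exp 1 (2 * 1) m) = of_nat (theta_exp n (2 * n) m)" for m
    by (simp add: theta_exp_def algebra_simps)
  then have E: "qsubst_pow n (qseries_of_fps euler_prod) = ?E"
    unfolding euler pentagonal_number_theorem[OF zero_less_one] pentagonal_number_theorem[OF assms]
    by (subst qsubst_pow_qsum[OF assms locally_finite_theta_exp]) simp_all
  have "?E * qsubst_pow n (qseries_of_fps (inverse euler_prod)) = 1"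
    unfolding E[symmetric] qsubst_pow_mult[OF assms, symmetric]
    using qseries_qpoch_inverse[of 1] assms by (simp add: euler qsubst_pow_one)
  then have "?I = ?I * (?E * qsubst_pow n (qseries_of_fps (inverse euler_prod)))" by simp
  also have "\<dots> = (?E * ?I) * qsubst_pow n (qseries_of_fps (inverse euler_prod))"
    by (simp only: mult_ac)
  also have "?E * ?I = 1" by (rule qseries_qpoch_inverse[OF assms])
  finally show ?thesis by simp
qed

text \<open>
  Reindexing by \<open>h\<close> turns the sum into its negative, so it vanishes in characteristic \<open>0\<close>.
\<close>

lemma qsum_antisymmetric:
  fixes c :: "'i \<Rightarrow> complex"
  assumes "locally_finite I e" "bij_betw h I I"
    and "\<And>i. i \<in> I \<Longrightarrow> c (h i) = - c i" "\<And>i. i \<in> I \<Longrightarrow> e (h i) = e i"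
  shows "qsum I c e = 0"
proof -
  have "qsum I c e = qsum I (\<lambda>i. - c i) e"
    unfolding qsum_reindex[OF assms(2), of c e] by (rule qsum_cong) (use assms in auto)
  also have "\<dots> = - qsum I c e" by (rule qsum_neg[OF assms(1)])
  finally have eq: "qsum I c e = - qsum I c e" .
  show ?thesis
  proof (rule qseries_eqI)
    fix x show "qcoeff (qsum I c e) x = qcoeff 0 x"
      using arg_cong[OF eq, of "\<lambda>f. qcoeff f x"] by simp
  qed
qed

text \<open>
  The change of variables behind the quintuple product: a pair \<open>(m, k)\<close> is replaced by the quotient \<open>t\<close>
  and the remainder \<open>r\<close> of \<open>m + 2 k\<close> modulo \<open>3\<close>, together with \<open>k - t\<close>.
\<close>

lemma bij_betw_int_shear:
  "bij_betw (\<lambda>(t, k). (t + r - 2 * k, t + k)) UNIV {(m, k). (m + 2 * k) mod 3 = r}"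
  if "r \<in> {0, 1, 2 :: int}"
proof (rule bij_betw_byWitness[where f' = "\<lambda>(m, k). ((m + 2 * k) div 3, k - (m + 2 * k) div 3)"])
  have *: "(t + r - 2 * k + 2 * (t + k)) div 3 = t" "(t + r - 2 * k + 2 * (t + k)) mod 3 = r" for t k
    using that by auto
  then show "\<forall>a\<in>UNIV. (case case a of (t, k) \<Rightarrow> (t + r - 2 * k, t + k) of
          (m, k) \<Rightarrow> ((m + 2 * k) div 3, k - (m + 2 * k) div 3)) = a"
    "(\<lambda>(t, k). (t + r - 2 * k, t + k)) ` UNIV \<subseteq> {(m, k). (m + 2 * k) mod 3 = r}"
    by auto
  show "\<forall>a'\<in>{(m, k). (m + 2 * k) mod 3 = r}.
       (case case a' of (m, k) \<Rightarrow> ((m + 2 * k) div 3, k - (m + 2 * k) div 3) of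
        (t, k) \<Rightarrow> (t + r - 2 * k, t + k)) = a'"
    by (clarsimp, presburger)
qed auto

lemma locally_finite_quadratic:
  assumes "A > 0"
  shows "locally_finite UNIV (\<lambda>t::int. A * (of_int t)\<^sup>2 + B * of_int t + C)"
  unfolding locally_finite_def
proof
  fix x
  have "locally_finite UNIV (\<lambda>t::int. (1 * of_int t + B / (2 * A))\<^sup>2 / (1 / A))"
    by (rule locally_finite_square) (use assms in auto)
  then have "finite {t::int. (1 * of_int t + B / (2 * A))\<^sup>2 / (1 / A) \<le> x - C + B\<^sup>2 / (4 * A)}"
    unfolding locally_finite_def by simp
  moreover have "(1 * of_int t + B / (2 * A))\<^sup>2 / (1 / A) = A * (of_int t)\<^sup>2 + B * of_int t + B\<^sup>2 / (4 * A)" for t :: int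
    using assms by (simp add: power2_eq_square field_simps)
  ultimately show "finite {t \<in> UNIV. A * (of_int t)\<^sup>2 + B * of_int t + C \<le> x}"
    by (simp add: algebra_simps)
qed

text \<open>
  With \<open>y = q\<^bsup>2v\<^esup>\<close> and \<open>z = q\<^sup>u\<close>, the left-hand side times \<open>(y\<^sup>2; y\<^sup>2)\<^sub>\<infinity>\<close> is a product of two Jacobi triple
  products, hence a double series over \<open>(m, k)\<close> in which \<open>z\<close> has exponent \<open>m + 2 k\<close>. The terms are sorted by
  \<open>r = (m + 2 k) mod 3\<close>. After the shear \<open>m + 2 k = 3 t + r\<close>, \<open>k = t + j\<close> the quadratic form in the
  exponent separates into a part in \<open>t\<close> and a part in \<open>j\<close>. For \<open>r = 0\<close> and \<open>r = 1\<close> the sum over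
  \<open>j\<close> is, up to sign, the pentagonal series of \<open>(y\<^sup>2; y\<^sup>2)\<^sub>\<infinity>\<close>; for \<open>r = 2\<close> it vanishes because \<open>j \<mapsto> 1 - j\<close>
  keeps the exponent and reverses the sign. Cancelling the unit \<open>(y\<^sup>2; y\<^sup>2)\<^sub>\<infinity>\<close> leaves the two series
  over \<open>t\<close>.
\<close>

theorem quintuple_product:
  fixes u v :: nat
  assumes "v > 0" "u \<le> v"
  shows "qseries_of_fps
      (qpoch [fps_X ^ u, fps_X ^ (2 * v - u), fps_X ^ (2 * v)] (fps_X ^ (2 * v)) *
       qpoch [fps_X ^ (2 * (v + u)), fps_X ^ (2 * (v - u))] (fps_X ^ (4 * v))) =
    qsum UNIV (\<lambda>_. 1) (\<lambda>t::int. of_nat v * (3 * (of_int t)\<^sup>2 - of_int t) + 3 * of_nat u * of_int t) -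
    qsum UNIV (\<lambda>_. 1) (\<lambda>t::int. of_nat v * (3 * (of_int t)\<^sup>2 + of_int t) + of_nat u * (3 * of_int t + 1))"
proof -
  define V U where "V = rat_of_nat v" and "U = rat_of_nat u"
  define e1 e2 e3 where "e1 = (\<lambda>m. rat_of_nat (theta_exp u (2 * v - u) m))"
    and "e2 = (\<lambda>k. rat_of_nat (theta_exp (2 * (v + u)) (2 * (v - u)) k))"
    and "e3 = (\<lambda>k. rat_of_nat (theta_exp (4 * v) (8 * v) k))"
  have ex: "2 * rat_of_nat (theta_exp a b m) = of_nat a * (of_int m * (of_int m + 1)) + of_nat b * (of_int m * (of_int m - 1))" for a b m
    using arg_cong[OF two_theta_exp[of a b m], of rat_of_int] by simp
  have e1: "e1 m = V * (of_int m * (of_int m - 1)) + U * of_int m" for m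
    using ex[of u "2 * v - u" m] assms unfolding e1_def V_def U_def by (simp add: of_nat_diff algebra_simps)
  have e2: "e2 k = 2 * V * (of_int k)\<^sup>2 + 2 * U * of_int k" for k
    using ex[of "2 * (v + u)" "2 * (v - u)" k] assms unfolding e2_def V_def U_def
    by (simp add: of_nat_diff algebra_simps power2_eq_square)
  have e3: "e3 k = V * (6 * (of_int k)\<^sup>2 - 2 * of_int k)" for k
    using ex[of "4 * v" "8 * v" k] unfolding e3_def V_def
    by (simp add: algebra_simps power2_eq_square)
  have lf: "locally_finite UNIV e1" "locally_finite UNIV e2" "locally_finite UNIV e3"
    unfolding e1_def e2_def e3_def using assms by (auto intro!: locally_finite_theta_exp)
  define d0 where "d0 = (\<lambda>t::int. V * (3 * (of_int t)\<^sup>2 - of_int t) + 3 * U * of_int t)"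
  define d1 where "d1 = (\<lambda>t::int. V * (3 * (of_int t)\<^sup>2 + of_int t) + U * (3 * of_int t + 1))"
  have V: "V > 0" using assms by (simp add: V_def)
  have lfd: "locally_finite UNIV d0" "locally_finite UNIV d1"
    using locally_finite_quadratic[of "3 * V" "3 * U - V" 0] V
      locally_finite_quadratic[of "3 * V" "3 * U + V" U]
    by (simp_all add: d0_def d1_def algebra_simps)
  define E3 :: "complex qseries" where "E3 = qsum UNIV alt_sign e3"
  define c where "c = (\<lambda>(m, k). alt_sign m * alt_sign k :: complex)"
  define e where "e = (\<lambda>(m, k). e1 m + e2 k)"
  define S where "S = (\<lambda>r. {(m, k). (m + 2 * k) mod 3 = (r :: int)})"
  have lfe: "locally_finite UNIV e"
    using locally_finite_sum[OF lf(1,2)] by (simp add: e_def)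
  have UN: "(\<Union>r\<in>{0, 1, 2}. S r) = UNIV" by (auto simp: S_def)
  have disj: "disjoint_family_on S {0, 1, 2}" by (auto simp: disjoint_family_on_def S_def)
  have split: "qsum UNIV c e = (\<Sum>r\<in>{0, 1, 2}. qsum (S r) c e)"
    using qsum_UN[OF _ _ disj, of e c, unfolded UN] lfe by blast
  define g where "g = (\<lambda>r :: int. \<lambda>(t :: int, k :: int).
      V * (3 * (of_int t)\<^sup>2 + (2 * of_int r - 1) * of_int t + 6 * (of_int k)\<^sup>2
           - (4 * of_int r - 2) * of_int k + (of_int r)\<^sup>2 - of_int r)
      + U * (3 * of_int t + of_int r))"
  have eg: "e (case p of (t, k) \<Rightarrow> (t + r - 2 * k, t + k)) = g r p" for r p
    by (cases p) (simp add: e_def e1 e2 g_def power2_eq_square algebra_simps)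
  have shear: "qsum (S r) c e = qsum UNIV (\<lambda>(t, k). alt_sign (r + k)) (g r)"
    if "r \<in> {0, 1, 2}" for r
    unfolding S_def qsum_reindex[OF bij_betw_int_shear[OF that]] eg
    by (rule qsum_cong) (auto simp: c_def alt_sign_def)
  \<comment> \<open>The sum over \<open>k\<close> is the pentagonal series with \<open>k\<close> replaced by \<open>- k\<close>.\<close>
  have r0: "qsum (S 0) c e = qsum UNIV (\<lambda>_. 1) d0 * E3"
  proof -
    have "bij_betw uminus (UNIV :: int set) UNIV" by (rule bij_uminus)
    from qsum_reindex[OF this, of alt_sign e3]
    have E3: "E3 = qsum UNIV alt_sign (\<lambda>k. e3 (- k))"
      unfolding E3_def alt_sign_minus .
    have lf': "locally_finite UNIV (\<lambda>k. e3 (- k))"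
      by (rule locally_finite_reindex[OF lf(3)]) auto
    show ?thesis unfolding E3 qsum_mult[OF lfd(1) lf'] shear[of 0, OF insertI1]
      by (rule qsum_cong) (auto simp: d0_def e3 g_def algebra_simps)
  qed
  have r1: "qsum (S 1) c e = - (qsum UNIV (\<lambda>_. 1) d1 * E3)"
  proof -
    have "qsum (S 1) c e = qsum (UNIV \<times> UNIV) (\<lambda>i. - (case i of (t, k) \<Rightarrow> 1 * alt_sign k)) (\<lambda>(t, k). d1 t + e3 k)"
      unfolding shear[of 1, simplified]
      by (rule qsum_cong) (auto simp: d1_def e3 g_def algebra_simps alt_sign_def)
    also have "\<dots> = - (qsum UNIV (\<lambda>_. 1) d1 * E3)"
      unfolding E3_def qsum_mult[OF lfd(2) lf(3)]
      by (rule qsum_neg[OF locally_finite_sum[OF lfd(2) lf(3)]])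
    finally show ?thesis .
  qed
  have r2: "qsum (S 2) c e = 0"
    unfolding shear[of 2, simplified]
  proof (rule qsum_antisymmetric[where h = "\<lambda>(t, k). (t, 1 - k)"])
    have "locally_finite UNIV (\<lambda>p. e (case p of (t, k) \<Rightarrow> (t + 2 - 2 * k, t + k)))"
      by (rule locally_finite_reindex[OF lfe]) (auto simp: inj_on_def)
    then show "locally_finite UNIV (g 2)" by (simp only: eg)
    show "bij_betw (\<lambda>(t, k). (t, 1 - k)) UNIV (UNIV :: (int \<times> int) set)"
      by (rule bij_betw_byWitness[where f' = "\<lambda>(t, k). (t, 1 - k)"]) auto
  qed (auto simp: alt_sign_def g_def algebra_simps power2_eq_square)
  let ?P1 = "qpoch [fps_X ^ u, fps_X ^ (2 * v - u), fps_X ^ (2 * v)] (fps_X ^ (2 * v))"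
  let ?R = "qpoch [fps_X ^ (2 * (v + u)), fps_X ^ (2 * (v - u))] (fps_X ^ (4 * v))"
  let ?Y = "qpoch [fps_X ^ (4 * v)] (fps_X ^ (4 * v))"
  have P1: "qseries_of_fps ?P1 = qsum UNIV alt_sign e1"
    using jacobi_triple_product[of u "2 * v - u"] assms unfolding e1_def by simp
  have sum4: "2 * (v + u) + 2 * (v - u) = 4 * v" using assms by simp
  have "?R * ?Y = qpoch [fps_X ^ (2 * (v + u)), fps_X ^ (2 * (v - u)), fps_X ^ (4 * v)] (fps_X ^ (4 * v))"
    using qpoch_append[of "4 * v" "[2 * (v + u), 2 * (v - u)]" "[4 * v]"] assms by simp
  moreover have "qseries_of_fps \<dots> = qsum UNIV alt_sign e2"
    unfolding e2_def
    by (rule jacobi_triple_product[of "2 * (v + u)" "2 * (v - u)", unfolded sum4])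
       (use assms in simp)
  ultimately have P2: "qseries_of_fps (?R * ?Y) = qsum UNIV alt_sign e2" by simp
  have Y: "qseries_of_fps ?Y = E3"
    using pentagonal_number_theorem[of "4 * v"] assms by (simp add: E3_def e3_def)
  have "qseries_of_fps ?P1 * qseries_of_fps (?R * ?Y) = qsum UNIV c e"
    unfolding P1 P2 qsum_mult[OF lf(1,2)] c_def e_def by simp
  also have "\<dots> = (qsum UNIV (\<lambda>_. 1) d0 - qsum UNIV (\<lambda>_. 1) d1) * E3"
    unfolding split by (simp add: r0 r1 r2 left_diff_distrib)
  finally have "qseries_of_fps (?P1 * ?R) * qseries_of_fps ?Y =
      (qsum UNIV (\<lambda>_. 1) d0 - qsum UNIV (\<lambda>_. 1) d1) * qseries_of_fps ?Y"
    unfolding Y[symmetric] by (simp add: qseries_of_fps_mult mult_ac)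
  then have "qseries_of_fps (?P1 * ?R) * (qseries_of_fps ?Y * qseries_of_fps (inverse ?Y)) =
      (qsum UNIV (\<lambda>_. 1) d0 - qsum UNIV (\<lambda>_. 1) d1) * (qseries_of_fps ?Y * qseries_of_fps (inverse ?Y))"
    by (simp only: mult.assoc[symmetric])
  then show ?thesis
    using qseries_qpoch_inverse[of "4 * v"] assms
    by (simp add: d0_def d1_def V_def U_def)
qed

section \<open>Theta series of residue classes and the Kac table\<close>

definition residue_class :: "int \<Rightarrow> int \<Rightarrow> int set" where
  "residue_class M h = {N. M dvd N - h}"

lemma residue_class_minus: "residue_class M (- h) = uminus ` residue_class M h"
proof (intro set_eqI iffI)
  fix N assume "N \<in> residue_class M (- h)"
  then have "M dvd N + h" by (simp add: residue_class_def)
  then have "M dvd - N - h" by (metis dvd_minus_iff minus_add_distrib uminus_add_conv_diff add.commute)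
  then show "N \<in> uminus ` residue_class M h"
    by (intro image_eqI[of _ _ "- N"]) (auto simp: residue_class_def)
next
  fix N assume "N \<in> uminus ` residue_class M h"
  then have "M dvd - N - h" by (auto simp: residue_class_def)
  then show "N \<in> residue_class M (- h)"
    unfolding residue_class_def by (metis dvd_minus_iff minus_diff_eq mem_Collect_eq diff_minus_eq_add minus_add_distrib uminus_add_conv_diff add.commute)
qed

text \<open>
  Modulo \<open>2 P Q\<close>, every integer divisible by neither \<open>P\<close> nor \<open>Q\<close> is of the form \<open>Q r + P s\<close>: first \<open>s\<close> is determined
  modulo \<open>Q\<close>, then \<open>r\<close> modulo \<open>2 P\<close>, and the latter is represented in the symmetric interval.
\<close>

lemma residue_decomposition:
  fixes P Q N :: int
  assumes "coprime P Q" "P > 0" "Q > 0" "\<not> P dvd N" "\<not> Q dvd N"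
  obtains r s where "0 < \<bar>r\<bar>" "\<bar>r\<bar> < P" "0 < s" "s < Q" "2 * P * Q dvd N - (Q * r + P * s)"
proof -
  obtain x y where xy: "P * x + Q * y = 1"
    using bezout_int[of P Q] assms(1) by (auto simp: mult.commute)
  define s where "s = (N * x) mod Q"
  have "Q dvd N * x - s" by (simp add: s_def)
  then have "Q dvd P * (N * x - s) + Q * (N * y)" by (meson dvd_add dvd_mult dvd_triv_left)
  also have "P * (N * x - s) + Q * (N * y) = N * (P * x + Q * y) - P * s"
    by (simp add: algebra_simps)
  finally have Q: "Q dvd N - P * s" by (simp add: xy)
  have s: "0 \<le> s" "s < Q" using assms by (auto simp: s_def)
  have "s \<noteq> 0" using Q assms(5) by auto
  with s have s: "0 < s" "s < Q" by auto
  from Q obtain w where w: "N - P * s = Q * w" by (elim dvdE)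
  define r0 where "r0 = w mod (2 * P)"
  have r0: "0 \<le> r0" "r0 < 2 * P" using assms by (auto simp: r0_def)
  have "2 * P dvd w - r0" by (simp add: r0_def)
  then have "Q * (2 * P) dvd Q * (w - r0)" by (rule mult_dvd_mono[OF dvd_refl])
  then have d0: "2 * P * Q dvd N - (Q * r0 + P * s)"
    using w by (simp add: algebra_simps)
  have "\<not> P dvd r0"
  proof
    assume "P dvd r0"
    moreover have "P dvd N - (Q * r0 + P * s)" using d0 by (metis dvd_mult_left dvd_mult_right mult.assoc)
    moreover from \<open>P dvd r0\<close> have "P dvd Q * r0 + P * s" by simp
    ultimately have "P dvd (N - (Q * r0 + P * s)) + (Q * r0 + P * s)" by (blast intro: dvd_add)
    with assms(4) show False by simp
  qed
  then have nz: "r0 \<noteq> 0" "r0 \<noteq> P" by auto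
  show ?thesis
  proof (cases "r0 < P")
    case True
    with r0 nz s d0 show ?thesis by (intro that[of r0 s]) auto
  next
    case False
    have e: "N - (Q * (r0 - 2 * P) + P * s) = (N - (Q * r0 + P * s)) + 2 * P * Q"
      by (simp add: algebra_simps)
    have "2 * P * Q dvd N - (Q * (r0 - 2 * P) + P * s)"
      unfolding e using d0 by (rule dvd_add) simp
    with False r0 nz s show ?thesis by (intro that[of "r0 - 2 * P" s]) auto
  qed
qed

lemma residue_decomposition_unique:
  fixes P Q r s r' s' :: int
  assumes "coprime P Q" "0 < \<bar>r\<bar>" "\<bar>r\<bar> < P" "0 < s" "s < Q" "0 < \<bar>r'\<bar>" "\<bar>r'\<bar> < P" "0 < s'" "s' < Q"
    and "2 * P * Q dvd (Q * r + P * s) - (Q * r' + P * s')"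
  shows "r = r' \<and> s = s'"
proof -
  have D: "2 * P * Q dvd Q * (r - r') + P * (s - s')"
    using assms(10) by (simp add: algebra_simps)
  have "Q dvd Q * (r - r') + P * (s - s')" using D by (rule dvd_mult_right)
  then have "Q dvd P * (s - s')" by (simp add: dvd_add_right_iff)
  then have "Q dvd s - s'" using assms(1) by (simp add: coprime_dvd_mult_right_iff coprime_commute)
  moreover have "\<bar>s - s'\<bar> < Q" using assms by auto
  ultimately have s: "s = s'" using dvd_imp_le_int[of "s - s'" Q] by auto
  with D have "2 * P * Q dvd (r - r') * Q" by (simp add: mult.commute)
  then have "2 * P dvd r - r'" using assms by simp
  moreover have "\<bar>r - r'\<bar> < 2 * P" using assms by auto
  ultimately have "r = r'" using dvd_imp_le_int[of "r - r'" "2 * P"] by auto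
  with s show ?thesis by simp
qed

definition theta_sum :: "rat \<Rightarrow> int set \<Rightarrow> complex qseries" where
  "theta_sum \<kappa> S = qsum S (\<lambda>_. 1) (\<lambda>N. \<kappa> * (of_int N)\<^sup>2)"

lemma locally_finite_theta_sum:
  assumes "\<kappa> > 0"
  shows   "locally_finite S (\<lambda>N::int. \<kappa> * (of_int N)\<^sup>2)"
proof (rule locally_finite_subset)
  show "locally_finite UNIV (\<lambda>N::int. \<kappa> * (of_int N)\<^sup>2)"
    using locally_finite_square[of 1 "1 / \<kappa>" 0] assms by (simp add: mult.commute)
qed simp

lemma theta_sum_uminus: "theta_sum \<kappa> (uminus ` S) = theta_sum \<kappa> S"
  unfolding theta_sum_def
  by (subst qsum_reindex[of uminus S "uminus ` S"]) (auto simp: bij_betw_def)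

lemma theta_sum_residue_class:
  assumes "M > 0"
  shows   "theta_sum \<kappa> (residue_class M h) =
           qsum UNIV (\<lambda>_. 1) (\<lambda>j::int. \<kappa> * (of_int M * of_int j + of_int h)\<^sup>2)"
proof -
  have "bij_betw (\<lambda>j. M * j + h) UNIV (residue_class M h)"
    by (rule bij_betw_byWitness[where f' = "\<lambda>N. (N - h) div M"])
       (use assms in \<open>auto simp: residue_class_def\<close>)
  show ?thesis
    unfolding theta_sum_def qsum_reindex[OF \<open>bij_betw _ _ _\<close>] of_int_add of_int_mult ..
qed

definition kac_table :: "int \<Rightarrow> int \<Rightarrow> (int \<times> int) set" where
  "kac_table P Q = {0<..<P} \<times> {0<..<Q}"

text \<open>
  The residues \<open>Q r + P s\<close> with \<open>0 < \<bar>r\<bar> < P\<close> and \<open>0 < s < Q\<close> run exactly once through the classes modulo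
  \<open>2 P Q\<close> that consist of integers divisible by neither \<open>P\<close> nor \<open>Q\<close>. So the part of a periodic set \<open>S\<close>
  outside the multiples of \<open>P\<close> and \<open>Q\<close> is a disjoint union of such classes. The classes with
  negative \<open>r\<close> are reflected at \<open>0\<close>, which does not change their theta series, to make both sums range
  over the Kac table.
\<close>

lemma theta_sum_kac:
  fixes P Q :: int and S :: "int set"
  assumes "coprime P Q" "P > 0" "Q > 0" "\<kappa> > 0"
    and periodic: "\<And>N N'. 2 * P * Q dvd N - N' \<Longrightarrow> N \<in> S \<longleftrightarrow> N' \<in> S"
  shows "theta_sum \<kappa> {N \<in> S. \<not> P dvd N \<and> \<not> Q dvd N} =
     (\<Sum>(r, s) | (r, s) \<in> kac_table P Q \<and> Q * r + P * s \<in> S.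
        theta_sum \<kappa> (residue_class (2 * P * Q) (Q * r + P * s))) +
     (\<Sum>(r, s) | (r, s) \<in> kac_table P Q \<and> - (Q * r - P * s) \<in> S.
        theta_sum \<kappa> (residue_class (2 * P * Q) (Q * r - P * s)))"
proof -
  define M where "M = 2 * P * Q"
  define C where "C = (\<lambda>(r, s). residue_class M (Q * r + P * s))"
  define K1 where "K1 = {(r, s). (r, s) \<in> kac_table P Q \<and> Q * r + P * s \<in> S}"
  define K2 where "K2 = {(r, s). (r, s) \<in> kac_table P Q \<and> - (Q * r - P * s) \<in> S}"
  define neg where "neg = (\<lambda>(r, s). (- r, s) :: int \<times> int)"
  have fin: "finite K1" "finite K2"
    by (rule finite_subset[of _ "kac_table P Q"]; auto simp: K1_def K2_def kac_table_def)+
  have inj: "inj_on neg K2" by (auto simp: inj_on_def neg_def)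
  have box: "0 < \<bar>r\<bar> \<and> \<bar>r\<bar> < P \<and> 0 < s \<and> s < Q \<and> Q * r + P * s \<in> S"
    if "(r, s) \<in> K1 \<union> neg ` K2" for r s
    using that by (auto simp: K1_def K2_def kac_table_def neg_def)
  have nd: "\<not> P dvd N \<and> \<not> Q dvd N"
    if "(r, s) \<in> K1 \<union> neg ` K2" "M dvd N - (Q * r + P * s)" for r s N
  proof -
    have PQ: "P dvd N - (Q * r + P * s)" "Q dvd N - (Q * r + P * s)"
      using that(2) unfolding M_def by (metis dvd_mult_left dvd_mult_right mult.assoc)+
    show ?thesis
    proof (intro conjI notI)
      assume "P dvd N"
      with PQ(1) have "P dvd Q * r + P * s" by (metis dvd_diff_right_iff)
      then have "P dvd Q * r" by (simp add: dvd_add_left_iff)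
      then have "P dvd r" using assms(1) by (simp add: coprime_dvd_mult_right_iff)
      with box[OF that(1)] show False using dvd_imp_le_int[of r P] by auto
    next
      assume "Q dvd N"
      with PQ(2) have "Q dvd Q * r + P * s" by (metis dvd_diff_right_iff)
      then have "Q dvd P * s" by (simp add: dvd_add_right_iff)
      then have "Q dvd s" using assms(1) by (simp add: coprime_dvd_mult_right_iff coprime_commute)
      with box[OF that(1)] show False using dvd_imp_le_int[of s Q] by auto
    qed
  qed
  have UN: "{N \<in> S. \<not> P dvd N \<and> \<not> Q dvd N} = (\<Union>p\<in>K1 \<union> neg ` K2. C p)"
  proof (intro set_eqI iffI)
    fix N assume N: "N \<in> {N \<in> S. \<not> P dvd N \<and> \<not> Q dvd N}"
    with assms(1-3) obtain r s where rs: "0 < \<bar>r\<bar>" "\<bar>r\<bar> < P" "0 < s" "s < Q" "M dvd N - (Q * r + P * s)"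
      unfolding M_def by (auto elim: residue_decomposition)
    have S: "Q * r + P * s \<in> S" using periodic[of N "Q * r + P * s"] rs(5) N by (simp add: M_def)
    have "(r, s) \<in> K1 \<union> neg ` K2"
    proof (cases "r > 0")
      case True
      then show ?thesis using rs S by (auto simp: K1_def kac_table_def)
    next
      case False
      then have "(r, s) \<in> neg ` K2"
        using rs S by (intro image_eqI[of _ _ "(- r, s)"]) (auto simp: K2_def kac_table_def neg_def algebra_simps)
      then show ?thesis ..
    qed
    then show "N \<in> (\<Union>p\<in>K1 \<union> neg ` K2. C p)"
      using rs(5) by (intro UN_I) (auto simp: C_def residue_class_def)
  next
    fix N assume "N \<in> (\<Union>p\<in>K1 \<union> neg ` K2. C p)"
    then obtain r s where rs: "(r, s) \<in> K1 \<union> neg ` K2" "M dvd N - (Q * r + P * s)"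
      by (force simp: C_def residue_class_def)
    then show "N \<in> {N \<in> S. \<not> P dvd N \<and> \<not> Q dvd N}"
      using nd[OF rs] box[OF rs(1)] periodic[of N "Q * r + P * s"] by (simp add: M_def)
  qed
  have disj: "disjoint_family_on C (K1 \<union> neg ` K2)"
    unfolding disjoint_family_on_def
  proof (intro ballI impI, rule ccontr)
    fix p q assume pq: "p \<in> K1 \<union> neg ` K2" "q \<in> K1 \<union> neg ` K2" "p \<noteq> q" "C p \<inter> C q \<noteq> {}"
    obtain r s r' s' where rs: "p = (r, s)" "q = (r', s')" by (cases p, cases q) blast
    from pq(4) obtain N where "M dvd N - (Q * r + P * s)" "M dvd N - (Q * r' + P * s')"
      by (auto simp: rs C_def residue_class_def)
    from dvd_diff[OF this(2,1)] have "M dvd (Q * r + P * s) - (Q * r' + P * s')"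
      by (simp add: algebra_simps)
    then have "r = r' \<and> s = s'"
      using box[of r s] box[of r' s'] pq(1,2) assms(1) unfolding M_def rs
      by (intro residue_decomposition_unique[of P Q]) auto
    with pq(3) rs show False by simp
  qed
  have "theta_sum \<kappa> {N \<in> S. \<not> P dvd N \<and> \<not> Q dvd N} = (\<Sum>p\<in>K1 \<union> neg ` K2. theta_sum \<kappa> (C p))"
    unfolding UN theta_sum_def
    by (rule qsum_UN) (use fin disj locally_finite_theta_sum[OF assms(4)] in auto)
  also have "\<dots> = (\<Sum>p\<in>K1. theta_sum \<kappa> (C p)) + (\<Sum>p\<in>neg ` K2. theta_sum \<kappa> (C p))"
  proof (rule sum.union_disjoint)
    show "K1 \<inter> neg ` K2 = {}" by (auto simp: K1_def K2_def kac_table_def neg_def)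
  qed (use fin in auto)
  also have "(\<Sum>p\<in>neg ` K2. theta_sum \<kappa> (C p)) = (\<Sum>p\<in>K2. theta_sum \<kappa> (C (neg p)))"
    by (simp add: sum.reindex[OF inj])
  also have "\<dots> = (\<Sum>(r, s)\<in>K2. theta_sum \<kappa> (residue_class M (Q * r - P * s)))"
  proof (rule sum.cong)
    fix p assume "p \<in> K2"
    obtain r s where p: "p = (r, s)" by (cases p)
    have "C (neg p) = residue_class M (- (Q * r - P * s))" by (simp add: C_def neg_def p)
    then show "theta_sum \<kappa> (C (neg p)) = (case p of (r, s) \<Rightarrow> theta_sum \<kappa> (residue_class M (Q * r - P * s)))"
      by (simp add: p residue_class_minus theta_sum_uminus del: minus_diff_eq)
  qed simp
  also have "(\<Sum>p\<in>K1. theta_sum \<kappa> (C p)) = (\<Sum>(r, s)\<in>K1. theta_sum \<kappa> (residue_class M (Q * r + P * s)))"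
    by (rule sum.cong) (auto simp: C_def)
  finally show ?thesis by (simp add: K1_def K2_def M_def)
qed

text \<open>
  The two sides differ by \<open>2 (x - 3 c)\<close>. Either one implies \<open>a dvd x - 3 c\<close>, since \<open>a dvd y\<close>; and
  \<open>3 dvd x - 3 c\<close> anyway, so \<open>6 a\<close> divides the difference. With \<open>x = P s\<close> and \<open>y = Q r\<close> it says that the
  condition on \<open>Q r - P s\<close> defining an index set is at the same time a condition on \<open>Q r + P s\<close>.
\<close>

lemma six_dvd_sign_change:
  fixes a c x y :: int
  assumes "coprime 3 a" "3 dvd x" "a dvd y"
  shows "6 * a dvd y - x - a + 3 * c \<longleftrightarrow> 6 * a dvd y + x - a - 3 * c"
proof
  assume *: "6 * a dvd y - x - a + 3 * c"
  then have "a dvd y - x - a + 3 * c" by (rule dvd_mult_right)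
  with assms(3) have "a dvd (y - a) - (y - x - a + 3 * c)" by (intro dvd_diff[of _ "y - a"]) simp_all
  then have "a dvd x - 3 * c" by simp
  moreover have "3 dvd x - 3 * c" using assms(2) by (intro dvd_diff) auto
  ultimately have "3 * a dvd x - 3 * c" using assms(1) by (simp add: divides_mult)
  then have "2 * (3 * a) dvd 2 * (x - 3 * c)" by (rule mult_dvd_mono[OF dvd_refl])
  then have "6 * a dvd 2 * (x - 3 * c)" by (simp only: mult.assoc[symmetric]) simp
  with * have "6 * a dvd (y - x - a + 3 * c) + 2 * (x - 3 * c)" by (rule dvd_add)
  then show "6 * a dvd y + x - a - 3 * c" by (simp add: algebra_simps)
next
  assume *: "6 * a dvd y + x - a - 3 * c"
  then have "a dvd y + x - a - 3 * c" by (rule dvd_mult_right)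
  moreover from assms(3) have "a dvd y - a" by simp
  ultimately have "a dvd (y + x - a - 3 * c) - (y - a)" by (rule dvd_diff)
  then have "a dvd x - 3 * c" by simp
  moreover have "3 dvd x - 3 * c" using assms(2) by (intro dvd_diff) auto
  ultimately have "3 * a dvd x - 3 * c" using assms(1) by (simp add: divides_mult)
  then have "2 * (3 * a) dvd 2 * (x - 3 * c)" by (rule mult_dvd_mono[OF dvd_refl])
  then have "6 * a dvd 2 * (x - 3 * c)" by (simp only: mult.assoc[symmetric]) simp
  with * have "6 * a dvd (y + x - a - 3 * c) - 2 * (x - 3 * c)" by (rule dvd_diff)
  then show "6 * a dvd y - x - a + 3 * c" by (simp add: algebra_simps)
qed

text \<open>
  The decomposition \<open>theta_sum_kac\<close> is used for the class \<open>U\<close> of \<open>3 c - a\<close> and the class \<open>V\<close> of \<open>a + 3 c\<close> modulo \<open>6 a\<close>.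
  For \<open>U\<close> it yields, as the theta series does not distinguish \<open>U\<close> from the class of \<open>a - 3 c\<close>,
  the terms with positive sign on the right, namely \<open>Q r - P s\<close> for \<open>A1\<close> and
  \<open>Q r + P s\<close> for \<open>A2\<close>; for \<open>V\<close>, after \<open>six_dvd_sign_change\<close>, those with negative sign. The multiples
  of \<open>P\<close> or \<open>Q\<close> left out on the way are harmless: if \<open>c > 0\<close> neither class contains any, because \<open>3\<close> does not
  divide \<open>a\<close> and \<open>a\<close> does not divide \<open>3 c\<close>, and if \<open>c = 0\<close> then \<open>U = - V\<close>, so that both sides are zero.
\<close>

theorem theta_sum_kac_difference:
  fixes P Q a c :: int
  assumes "coprime P Q" "P > 0" "Q > 0" "\<kappa> > 0" "3 dvd P" "a dvd Q" "0 \<le> c" "c < a"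
  defines "A1 \<equiv> {(r, s). (r, s) \<in> kac_table P Q \<and> 6 * a dvd Q * r - P * s - a + 3 * c}"
  defines "A2 \<equiv> {(r, s). (r, s) \<in> kac_table P Q \<and> 6 * a dvd Q * r + P * s + a - 3 * c}"
  defines "D \<equiv> (\<lambda>(r, s). theta_sum \<kappa> (residue_class (2 * P * Q) (Q * r - P * s)) -
                         theta_sum \<kappa> (residue_class (2 * P * Q) (Q * r + P * s)))"
  shows "theta_sum \<kappa> (residue_class (6 * a) (a - 3 * c)) - theta_sum \<kappa> (residue_class (6 * a) (a + 3 * c))
       = (\<Sum>p\<in>A1. D p) - (\<Sum>p\<in>A2. D p)"
proof -
  have cop: "coprime 3 a"
    using assms(1,5,6) coprime_divisors by blast
  have "3 * a dvd P * Q" using assms(5,6) by (rule mult_dvd_mono)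
  then have "2 * (3 * a) dvd 2 * (P * Q)" by (rule mult_dvd_mono[OF dvd_refl])
  then have aM: "6 * a dvd 2 * P * Q" by (simp add: mult.assoc)
  have per: "N \<in> residue_class (6 * a) h \<longleftrightarrow> N' \<in> residue_class (6 * a) h"
    if "2 * P * Q dvd N - N'" for N N' h
  proof -
    have "6 * a dvd N - N'" using aM that dvd_trans by blast
    then have "6 * a dvd (N - N') + (N' - h) \<longleftrightarrow> 6 * a dvd N' - h"
      by (rule dvd_add_right_iff)
    then show ?thesis by (simp add: residue_class_def)
  qed
  let ?T = "\<lambda>h. theta_sum \<kappa> (residue_class (2 * P * Q) h)"
  let ?U = "residue_class (6 * a) (- (a - 3 * c))" and ?V = "residue_class (6 * a) (a + 3 * c)"
  let ?nd = "\<lambda>S. {N \<in> S. \<not> P dvd N \<and> \<not> Q dvd N}"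
  have sc1: "6 * a dvd Q * r - P * s - a + 3 * c \<longleftrightarrow> 6 * a dvd Q * r + P * s - a - 3 * c" for r s
    using six_dvd_sign_change[OF cop, of "P * s" "Q * r" c] assms(5,6) by simp
  have sc2: "6 * a dvd Q * r + P * s + a - 3 * c \<longleftrightarrow> 6 * a dvd Q * r - P * s + a + 3 * c" for r s
  proof -
    have "6 * a dvd - (Q * r) - P * s - a + 3 * c \<longleftrightarrow> 6 * a dvd - (Q * r) + P * s - a - 3 * c"
      using six_dvd_sign_change[OF cop, of "P * s" "- (Q * r)" c] assms(5,6) by simp
    moreover have "- (Q * r) - P * s - a + 3 * c = - (Q * r + P * s + a - 3 * c)"
      "- (Q * r) + P * s - a - 3 * c = - (Q * r - P * s + a + 3 * c)" by simp_all
    ultimately show ?thesis by (simp only: dvd_minus_iff)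
  qed
  have memU1: "Q * r + P * s \<in> ?U \<longleftrightarrow> 6 * a dvd Q * r + P * s + a - 3 * c" for r s
    by (simp add: residue_class_def algebra_simps)
  have memU2: "- (Q * r - P * s) \<in> ?U \<longleftrightarrow> 6 * a dvd Q * r - P * s - a + 3 * c" for r s
  proof -
    have "- (Q * r - P * s) - (- (a - 3 * c)) = - (Q * r - P * s - a + 3 * c)" by simp
    then show ?thesis unfolding residue_class_def mem_Collect_eq by (simp only: dvd_minus_iff)
  qed
  have memV1: "Q * r + P * s \<in> ?V \<longleftrightarrow> 6 * a dvd Q * r - P * s - a + 3 * c" for r s
    unfolding sc1 by (simp add: residue_class_def algebra_simps)
  have memV2: "- (Q * r - P * s) \<in> ?V \<longleftrightarrow> 6 * a dvd Q * r + P * s + a - 3 * c" for r s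
  proof -
    have "- (Q * r - P * s) - (a + 3 * c) = - (Q * r - P * s + a + 3 * c)" by simp
    then show ?thesis unfolding residue_class_def mem_Collect_eq sc2 by (simp only: dvd_minus_iff)
  qed
  have U: "theta_sum \<kappa> (?nd ?U) = (\<Sum>(r, s)\<in>A2. ?T (Q * r + P * s)) + (\<Sum>(r, s)\<in>A1. ?T (Q * r - P * s))"
    using theta_sum_kac[OF assms(1-4) per, of "- (a - 3 * c)"]
    unfolding memU1 memU2 A1_def A2_def .
  have V: "theta_sum \<kappa> (?nd ?V) = (\<Sum>(r, s)\<in>A1. ?T (Q * r + P * s)) + (\<Sum>(r, s)\<in>A2. ?T (Q * r - P * s))"
    using theta_sum_kac[OF assms(1-4) per, of "a + 3 * c"]
    unfolding memV1 memV2 A1_def A2_def .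
  have diff: "theta_sum \<kappa> (?nd ?U) - theta_sum \<kappa> (?nd ?V) = (\<Sum>p\<in>A1. D p) - (\<Sum>p\<in>A2. D p)"
    unfolding U V D_def case_prod_beta by (simp add: sum_subtractf)
  show ?thesis
  proof (cases "c = 0")
    case True
    have "?U = uminus ` ?V" unfolding residue_class_minus using True by simp
    then have "?nd ?U = uminus ` ?nd ?V" by force
    then have "theta_sum \<kappa> (?nd ?U) = theta_sum \<kappa> (?nd ?V)" by (simp only: theta_sum_uminus)
    then show ?thesis using diff True by simp
  next
    case False
    have nd: "\<not> P dvd N \<and> \<not> Q dvd N" if "6 * a dvd N - h" "h = - (a - 3 * c) \<or> h = a + 3 * c" for N h
    proof (intro conjI notI)
      have "6 * a = 3 * (2 * a)" by simp
      then have "3 dvd N - h" using that(1) by (metis dvd_mult_left)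
      moreover assume "P dvd N"
      then have "3 dvd N" using assms(5) dvd_trans by blast
      ultimately have "3 dvd h" by (metis dvd_diff_right_iff)
      then have "3 dvd a" using that(2) by presburger
      with coprime_common_divisor[OF cop, of 3] show False by simp
    next
      have "a dvd N - h" using that(1) by (rule dvd_mult_right)
      moreover assume "Q dvd N"
      then have "a dvd N" using assms(6) dvd_trans by blast
      ultimately have "a dvd h" by (metis dvd_diff_right_iff)
      moreover have "3 * c = h + a \<or> 3 * c = h - a" using that(2) by auto
      ultimately have "a dvd 3 * c" by (metis dvd_add dvd_diff dvd_refl)
      then have "a dvd c" using cop by (simp add: coprime_dvd_mult_right_iff coprime_commute)
      with False assms(7,8) show False using zdvd_imp_le[of a c] by auto
    qed
    have "?nd ?U = ?U" "?nd ?V = ?V" using nd by (auto simp: residue_class_def)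
    then show ?thesis using diff by (simp only: residue_class_minus theta_sum_uminus)
  qed
qed

section \<open>The character identity\<close>

text \<open>
  Since \<open>n / (4 p p') = 1 / (12 B a')\<close> and \<open>p' r b - p s b' = B (Q r - P s)\<close>, \<open>2 p p' = B (2 P Q)\<close>, each exponent in the
  Rocha-Caridi formula becomes \<open>\<kappa> N\<^sup>2\<close> with \<open>N \<equiv> Q r \<mp> P s\<close> modulo \<open>2 P Q\<close>.
\<close>

lemma qsubst_virasoro_char:
  fixes p p' b b' a' n B :: nat and r s :: int
  assumes "p > 0" "p' > 0" "a' > 0" "b > 0" "b' > 0" "n > 0" "b dvd p" "b' dvd p'"
    and B: "B = b * b'" and n: "n * (3 * a' * B) = p * p'"
  defines "P \<equiv> int (p div b)" and "Q \<equiv> int (p' div b')"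
  defines "\<kappa> \<equiv> of_nat B / (12 * of_nat a')"
  shows "qsubst_pow n (virasoro_char p p' (r * int b) (s * int b')) =
     qpow (- ((of_nat p' - of_nat p)\<^sup>2 / (12 * of_nat B * of_nat a'))) *
     qseries_of_fps (inverse (qpoch [fps_X ^ n] (fps_X ^ n))) *
     (theta_sum \<kappa> (residue_class (2 * P * Q) (Q * r - P * s)) -
      theta_sum \<kappa> (residue_class (2 * P * Q) (Q * r + P * s)))"
proof -
  have pos: "B > 0" "P > 0" "Q > 0"
    using assms by (auto simp: P_def Q_def div_greater_zero_iff dvd_imp_le)
  have p: "rat_of_nat p = of_int P * of_nat b" and p': "rat_of_nat p' = of_int Q * of_nat b'"
    using assms(7,8) by (simp_all add: P_def Q_def flip: of_nat_mult)
  have "rat_of_nat (n * (3 * a' * B)) = of_nat (p * p')" using n by simp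
  then have n': "rat_of_nat n * (3 * of_nat a' * of_nat B) = of_nat p * of_nat p'" by simp
  have scale: "of_nat n * (x / (4 * of_nat p * of_nat p')) = x / (12 * of_nat B * of_nat a')" for x :: rat
  proof -
    have "4 * of_nat p * of_nat p' = 4 * (rat_of_nat n * (3 * of_nat a' * of_nat B))"
      by (simp add: n')
    then show ?thesis using assms(3,6) pos by (simp add: field_simps)
  qed
  have theta: "qsubst_pow n (formal_sum (\<lambda>j::int. qpow ((2 * of_nat p * of_nat p' * of_int j + h)\<^sup>2
        / (4 * of_nat p * of_nat p')))) = theta_sum \<kappa> (residue_class (2 * P * Q) N)"
    if "h = of_nat B * of_int N" for h N
  proof -
    have lf: "locally_finite UNIV (\<lambda>j::int. (2 * of_nat p * of_nat p' * of_int j + h)\<^sup>2 / (4 * of_nat p * of_nat p'))"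
      by (rule locally_finite_square) (use assms in auto)
    have "(2 * of_nat p * of_nat p' * of_int j + h)\<^sup>2 / (12 * of_nat B * of_nat a') =
      \<kappa> * (of_int (2 * P * Q) * of_int j + of_int N)\<^sup>2" for j :: int
    proof -
      have "2 * of_nat p * of_nat p' * of_int j + h = of_nat B * (of_int (2 * P * Q) * of_int j + of_int N)"
        unfolding p p' that by (simp add: B algebra_simps)
      then show ?thesis using pos assms(3) by (simp add: \<kappa>_def power2_eq_square)
    qed
    then show ?thesis
      unfolding formal_sum_qpow[OF lf] qsubst_pow_qsum[OF assms(6) lf] scale
      using pos by (subst theta_sum_residue_class) auto
  qed
  have minus: "qsubst_pow n (f - g) = qsubst_pow n f - (qsubst_pow n g :: complex qseries)" for f g
    using assms(6) by (intro qseries_eqI) (simp add: qsubst_pow.rep_eq)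
  have t1: "qsubst_pow n (formal_sum (\<lambda>j::int. qpow ((2 * of_nat p * of_nat p' * of_int j
        + of_nat p' * of_int (r * int b) - of_nat p * of_int (s * int b'))\<^sup>2 / (4 * of_nat p * of_nat p')))) =
      theta_sum \<kappa> (residue_class (2 * P * Q) (Q * r - P * s))"
    using theta[of "of_nat p' * of_int (r * int b) - of_nat p * of_int (s * int b')" "Q * r - P * s"]
    unfolding p p' by (simp add: B algebra_simps)
  have t2: "qsubst_pow n (formal_sum (\<lambda>j::int. qpow ((2 * of_nat p * of_nat p' * of_int j
        + of_nat p' * of_int (r * int b) + of_nat p * of_int (s * int b'))\<^sup>2 / (4 * of_nat p * of_nat p')))) =
      theta_sum \<kappa> (residue_class (2 * P * Q) (Q * r + P * s))"
    using theta[of "of_nat p' * of_int (r * int b) + of_nat p * of_int (s * int b')" "Q * r + P * s"]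
    unfolding p p' by (simp add: B algebra_simps)
  have "of_nat n * - ((rat_of_nat p' - of_nat p)\<^sup>2 / (4 * of_nat p * of_nat p')) =
      - ((rat_of_nat p' - of_nat p)\<^sup>2 / (12 * of_nat B * of_nat a'))"
    using scale[of "(rat_of_nat p' - of_nat p)\<^sup>2"] by simp
  then show ?thesis
    unfolding virasoro_char_def qsubst_pow_mult[OF assms(6)] qsubst_pow_qpow[OF assms(6)]
      qsubst_pow_inverse_euler_prod[OF assms(6)] minus t1 t2 by simp
qed

text \<open>
  Completing the square in both series of \<open>quintuple_product\<close> with \<open>u = B c\<close> and \<open>v = B a\<close>; the constants
  agree because \<open>(a + 3 c)\<^sup>2 - 12 a c = (a - 3 c)\<^sup>2\<close>. In the first series \<open>t\<close> has to be replaced by \<open>- t\<close>.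
\<close>

lemma quintuple_product_theta_sum:
  fixes a c B :: nat
  assumes "a > 0" "B > 0" "c \<le> a"
  defines "\<kappa> \<equiv> of_nat B / (12 * of_nat a)"
  shows "qseries_of_fps
      (qpoch [fps_X ^ (B * c), fps_X ^ (B * (2 * a - c)), fps_X ^ (2 * B * a)] (fps_X ^ (2 * B * a)) *
       qpoch [fps_X ^ (2 * B * (a + c)), fps_X ^ (2 * B * (a - c))] (fps_X ^ (4 * B * a))) =
    qpow (- ((of_nat a - 3 * of_nat c)\<^sup>2 * (of_nat B)\<^sup>2 / (12 * of_nat B * of_nat a))) *
    (theta_sum \<kappa> (residue_class (6 * int a) (int a - 3 * int c)) -
     theta_sum \<kappa> (residue_class (6 * int a) (int a + 3 * int c)))"
proof -
  define d where "d = - ((of_nat a - 3 * of_nat c)\<^sup>2 * (rat_of_nat B)\<^sup>2 / (12 * of_nat B * of_nat a))"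
  have pos: "\<kappa> > 0" "6 * int a > 0" using assms by (simp_all add: \<kappa>_def)
  have nats: "B * (2 * a - c) = 2 * (B * a) - B * c" "2 * B * a = 2 * (B * a)" "4 * B * a = 4 * (B * a)"
    "2 * B * (a + c) = 2 * (B * a + B * c)" "2 * B * (a - c) = 2 * (B * a - B * c)"
    by (simp_all add: algebra_simps diff_mult_distrib2)
  have theta: "qpow d * theta_sum \<kappa> (residue_class (6 * int a) h) =
      qsum UNIV (\<lambda>_. 1) (\<lambda>j::int. \<kappa> * (of_int (6 * int a) * of_int j + of_int h)\<^sup>2 + d)" for h
  proof -
    have "locally_finite UNIV (\<lambda>j::int. \<kappa> * (of_int (6 * int a * j + h))\<^sup>2)"
      by (rule locally_finite_reindex[OF locally_finite_theta_sum[OF pos(1), of UNIV]])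
         (use assms in \<open>auto simp: inj_on_def\<close>)
    then show ?thesis
      unfolding theta_sum_residue_class[OF pos(2)] by (subst qpow_mult_qsum) simp_all
  qed
  have "qseries_of_fps
      (qpoch [fps_X ^ (B * c), fps_X ^ (B * (2 * a - c)), fps_X ^ (2 * B * a)] (fps_X ^ (2 * B * a)) *
       qpoch [fps_X ^ (2 * B * (a + c)), fps_X ^ (2 * B * (a - c))] (fps_X ^ (4 * B * a))) =
    qsum UNIV (\<lambda>_. 1) (\<lambda>t::int. of_nat (B * a) * (3 * (of_int t)\<^sup>2 - of_int t) + 3 * of_nat (B * c) * of_int t) -
    qsum UNIV (\<lambda>_. 1) (\<lambda>t::int. of_nat (B * a) * (3 * (of_int t)\<^sup>2 + of_int t) + of_nat (B * c) * (3 * of_int t + 1))"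
    unfolding nats by (rule quintuple_product) (use assms in auto)
  also have "qsum UNIV (\<lambda>_. 1) (\<lambda>t::int. of_nat (B * a) * (3 * (of_int t)\<^sup>2 - of_int t) + 3 * of_nat (B * c) * of_int t) =
      qpow d * theta_sum \<kappa> (residue_class (6 * int a) (int a - 3 * int c))"
    unfolding theta
    by (subst qsum_reindex[OF bij_uminus], rule qsum_cong) (use assms in \<open>auto simp: d_def \<kappa>_def field_simps power2_eq_square\<close>)
  also have "qsum UNIV (\<lambda>_. 1) (\<lambda>t::int. of_nat (B * a) * (3 * (of_int t)\<^sup>2 + of_int t) + of_nat (B * c) * (3 * of_int t + 1)) =
      qpow d * theta_sum \<kappa> (residue_class (6 * int a) (int a + 3 * int c))"
    unfolding theta
    by (rule qsum_cong) (use assms in \<open>auto simp: d_def \<kappa>_def field_simps power2_eq_square\<close>)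
  finally show ?thesis by (simp add: d_def right_diff_distrib)
qed

lemma A1_3_A2_3_conv_kac_table:
  fixes p p' a' b b' c :: nat
  assumes "a' > 0" "b > 0" "b' > 0" "b dvd p" "b' dvd p'"
  defines "P \<equiv> int (p div b)" and "Q \<equiv> int (p' div b')"
  shows "A1_3 p p' a' b b' c =
    {(r, s). (r, s) \<in> kac_table P Q \<and> 6 * int a' dvd Q * r - P * s - int a' + 3 * int c}"
    and "A2_3 p p' a' b b' c =
    {(r, s). (r, s) \<in> kac_table P Q \<and> 6 * int a' dvd Q * r + P * s + int a' - 3 * int c}"
proof -
  have p: "rat_of_nat p = of_int P * of_nat b" and p': "rat_of_nat p' = of_int Q * of_nat b'"
    using assms(4,5) by (simp_all add: P_def Q_def flip: of_nat_mult)
  have Ints: "of_int x / (6 * of_nat a' :: rat) \<in> \<int> \<longleftrightarrow> 6 * int a' dvd x" for x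
    using assms(1) of_int_div_of_int_in_Ints_iff[of x "6 * int a'", where 'a = rat] by simp
  have 1: "(of_nat p' * of_int r / of_nat b' - of_nat p * of_int s / of_nat b - of_nat a' + 3 * of_nat c) / (6 * of_nat a')
      = of_int (Q * r - P * s - int a' + 3 * int c) / (6 * of_nat a' :: rat)"
    "(of_nat p' * of_int r / of_nat b' + of_nat p * of_int s / of_nat b + of_nat a' - 3 * of_nat c) / (6 * of_nat a')
      = of_int (Q * r + P * s + int a' - 3 * int c) / (6 * of_nat a' :: rat)" for r s
    unfolding p p' using assms(2,3) by simp_all
  have 2: "of_int r < (of_nat p / of_nat b :: rat) \<longleftrightarrow> r < P" "of_int s < (of_nat p' / of_nat b' :: rat) \<longleftrightarrow> s < Q" for r s
    unfolding p p' using assms(2,3) by simp_all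
  show "A1_3 p p' a' b b' c =
    {(r, s). (r, s) \<in> kac_table P Q \<and> 6 * int a' dvd Q * r - P * s - int a' + 3 * int c}"
    "A2_3 p p' a' b b' c =
    {(r, s). (r, s) \<in> kac_table P Q \<and> 6 * int a' dvd Q * r + P * s + int a' - 3 * int c}"
    unfolding A1_3_def A2_3_def 1 2 Ints kac_table_def by auto
qed

theorem theorem3p9:
  fixes p p' a' b b' c B n :: nat
  assumes "p > 1" and "p' > 1" and "coprime p p'"
    and "a' > 0" and "b > 0" and "b' > 0" and "a' > c"
    and "3 * b dvd p" and "a' * b' dvd p'"
    and B_def: "B = b * b'"
    and n_def: "of_nat n = (of_nat (p * p') / of_nat (3 * a' * b * b') :: rat)"
  shows
    "qseries_of_fps
       (qpoch [fps_X ^ (B * c), fps_X ^ (B * (2 * a' - c)), fps_X ^ (2 * B * a')]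
              (fps_X ^ (2 * B * a')) *
        qpoch [fps_X ^ (2 * B * (a' + c)), fps_X ^ (2 * B * (a' - c))] (fps_X ^ (4 * B * a')) /
        qpoch [fps_X ^ n] (fps_X ^ n)) =
     qpow (((of_nat p - of_nat p')\<^sup>2 - (of_nat a' - 3 * of_nat c)\<^sup>2 * (of_nat B)\<^sup>2)
             / (12 * of_nat B * of_nat a')) *
     ((\<Sum>(r, s)\<in>A1_3 p p' a' b b' c.
         qsubst_pow n (virasoro_char p p' (r * int b) (s * int b'))) -
      (\<Sum>(r, s)\<in>A2_3 p p' a' b b' c.
         qsubst_pow n (virasoro_char p p' (r * int b) (s * int b'))))"
proof -
  define P Q where "P = int (p div b)" and "Q = int (p' div b')"
  define \<kappa> where "\<kappa> = rat_of_nat B / (12 * of_nat a')"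
  define L where "L = qpoch [fps_X ^ (B * c), fps_X ^ (B * (2 * a' - c)), fps_X ^ (2 * B * a')]
              (fps_X ^ (2 * B * a')) *
        qpoch [fps_X ^ (2 * B * (a' + c)), fps_X ^ (2 * B * (a' - c))] (fps_X ^ (4 * B * a'))"
  define E where "E = qpoch [fps_X ^ n] (fps_X ^ n)"
  define x y where "x = - ((of_nat p' - of_nat p)\<^sup>2 / (12 * rat_of_nat B * of_nat a'))"
    and "y = - ((of_nat a' - 3 * of_nat c)\<^sup>2 * (of_nat B)\<^sup>2 / (12 * rat_of_nat B * of_nat a'))"
  define D where "D = (\<lambda>(r, s). theta_sum \<kappa> (residue_class (2 * P * Q) (Q * r - P * s)) -
                         theta_sum \<kappa> (residue_class (2 * P * Q) (Q * r + P * s)))"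
  have dvd: "b dvd p" "b' dvd p'" using assms(8,9) by (auto dest: dvd_mult_right)
  have pos: "p > 0" "p' > 0" "B > 0" using assms by auto
  have "rat_of_nat n * of_nat (3 * a' * b * b') = of_nat (p * p')"
    using assms(4-6) by (simp add: n_def)
  then have "rat_of_nat (n * (3 * a' * b * b')) = of_nat (p * p')" by (simp only: of_nat_mult)
  then have "n * (3 * a' * b * b') = p * p'" by (simp only: of_nat_eq_iff)
  then have n: "n * (3 * a' * B) = p * p'" by (simp add: B_def mult.assoc)
  have n0: "n > 0" using n pos by (intro gr0I) auto
  have P: "P > 0" "Q > 0"
    using dvd pos assms(5,6) by (auto simp: P_def Q_def div_greater_zero_iff dvd_imp_le)
  have "coprime (p div b) (p' div b')"
    by (rule coprime_divisors[OF _ _ assms(3)]) (use dvd in auto)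
  then have cop: "coprime P Q" by (simp add: P_def Q_def)
  have "3 dvd p div b" "a' dvd p' div b'"
    using assms(5,6,8,9) by (auto elim!: dvdE simp: mult.assoc mult.left_commute[of _ b])
  then have div: "3 dvd P" "int a' dvd Q"
    using of_nat_dvd_iff[of 3 "p div b", where 'a = int] by (simp_all add: P_def Q_def)
  have \<kappa>: "\<kappa> > 0" using pos assms(4) by (simp add: \<kappa>_def)
  have E0: "fps_nth E 0 \<noteq> 0" using qpoch_nth_0[OF n0] by (simp add: E_def)
  have char: "(case q of (r, s) \<Rightarrow> qsubst_pow n (virasoro_char p p' (r * int b) (s * int b'))) =
       qpow x * qseries_of_fps (inverse E) * D q" for q
    using qsubst_virasoro_char[OF pos(1,2) assms(4,5,6) n0 dvd B_def n]
    by (cases q) (simp add: D_def x_def E_def P_def Q_def \<kappa>_def)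
  have LHS: "qseries_of_fps L = qpow y *
    (theta_sum \<kappa> (residue_class (6 * int a') (int a' - 3 * int c)) -
     theta_sum \<kappa> (residue_class (6 * int a') (int a' + 3 * int c)))"
    unfolding L_def y_def \<kappa>_def by (rule quintuple_product_theta_sum) (use assms pos in auto)
  have key: "theta_sum \<kappa> (residue_class (6 * int a') (int a' - 3 * int c)) -
     theta_sum \<kappa> (residue_class (6 * int a') (int a' + 3 * int c)) =
     sum D (A1_3 p p' a' b b' c) - sum D (A2_3 p p' a' b b' c)"
    unfolding A1_3_A2_3_conv_kac_table[OF assms(4-6) dvd] D_def P_def[symmetric] Q_def[symmetric]
    by (rule theta_sum_kac_difference) (use cop P \<kappa> div assms(7) in auto)
  have "((of_nat p - of_nat p')\<^sup>2 - (of_nat a' - 3 * of_nat c)\<^sup>2 * (of_nat B)\<^sup>2)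
             / (12 * rat_of_nat B * of_nat a') = y - x"
    by (simp add: x_def y_def diff_divide_distrib power2_commute)
  then have qpow: "qpow (((of_nat p - of_nat p')\<^sup>2 - (of_nat a' - 3 * of_nat c)\<^sup>2 * (of_nat B)\<^sup>2)
             / (12 * rat_of_nat B * of_nat a')) * qpow x = (qpow y :: complex qseries)"
    unfolding qpow_add[symmetric] by simp
  have chars: "(\<Sum>(r, s)\<in>A. qsubst_pow n (virasoro_char p p' (r * int b) (s * int b'))) =
      qpow x * (qseries_of_fps (inverse E) * sum D A)" for A
    unfolding char sum_distrib_left[symmetric] mult.assoc ..
  have "qseries_of_fps (L / E) = qseries_of_fps L * qseries_of_fps (inverse E)"
    unfolding fps_divide_unit[OF E0] qseries_of_fps_mult ..
  also have "\<dots> = qpow y * (qseries_of_fps (inverse E) * (sum D (A1_3 p p' a' b b' c) - sum D (A2_3 p p' a' b b' c)))"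
    unfolding LHS key by (simp only: mult_ac)
  finally show ?thesis
    unfolding L_def[symmetric] E_def[symmetric] chars right_diff_distrib[symmetric]
      qpow[symmetric] mult.assoc[where 'a = "complex qseries"] .
qed

end
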